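(* Let $n\ge1$ and $I_{\mathbb{S}p(2n)}(\mathbf p)=\int_{S\in\mathbb{S}p(2n)}e^{\sum_{m\ge1}\frac1m p_m\,\mathrm{tr}\,S^m}\,d_*S$. Then $$I_{\mathbb{S}p(2n)}(\mathbf p)=\frac1{n!}\,\langle 2n|\,\Gamma(\mathbf p)\,e^{\frac1{4\pi i}\oint\psi(x^{-1})\psi(x)(x-x^{-1})\frac{dx}{x}}\,|0\rangle=\frac1{n!}\,\langle 2n|\,\Gamma(\mathbf p)\,e^{\sum_{i\in\mathbb Z}\psi_i\psi_{i-1}}\,|0\rangle .$$
   Context: $\mathbf p=(p_1,p_2,\dots)$ are free parameters (coupling constants). $d_*S$ is the Haar measure of the symplectic group $\mathbb{S}p(2n)$; explicitly, in terms of the eigenvalues $e^{\pm i\theta_1},\dots,e^{\pm i\theta_n}$ of $S$, $$I_{\mathbb{S}p(2n)}(\mathbf p)=\frac{2^{n^2}}{\pi^n}\int_{0\le\theta_1\le\cdots\le\theta_n\le\pi}\prod_{i<j}(\cos\theta_i-\cos\theta_j)^2\prod_{i=1}^n e^{2\sum_{m\ge1}\frac1m p_m\cos m\theta_i}\sin^2\theta_i\,d\theta_i .$$ Free fermions: $\psi_i,\psi_i^\dagger$ ($i\in\mathbb Z$) with $\psi_i\psi_j+\psi_j\psi_i=\psi_i^\dagger\psi_j^\dagger+\psi_j^\dagger\psi_i^\dagger=0$, $\psi_i\psi_j^\dagger+\psi_j^\dagger\psi_i=\delta_{i,j}$; $\psi(z)=\sum_{i\in\mathbb Z}\psi_iz^i$.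 The vacuum vectors satisfy $\psi_i|0\rangle=\psi^\dagger_{-1-i}|0\rangle=\langle0|\psi_{-1-i}=\langle0|\psi_i^\dagger=0$ for $i<0$ and $\langle0|0\rangle=1$; for $N>0$, $\langle N|=\langle0|\psi_0^\dagger\cdots\psi_{N-1}^\dagger$. Put $\alpha_m=\sum_{i\in\mathbb Z}\psi_i\psi^\dagger_{i+m}$ for $m>0$ and $\Gamma(\mathbf p)=e^{\sum_{m\ge1}\frac1m p_m\alpha_m}$. The contour integral is over the unit circle.
   Formalization: The factor 1/n! is dropped: with the stated measure and conventions the printed identity fails (n=2, p=0 gives 1=1/2). The p_m are complex numbers with Σ|p_m|/m<∞, so that the exponents converge; the Haar integral is the explicit eigenvalue formula. *)

theory Defs
  imports "HOL-Complex_Analysis.Complex_Analysis"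
begin

text \<open>
  A basis state of the fermionic Fock space is the set of its occupied levels, which differs from
  the Dirac sea of all negative levels by finitely many elements.
\<close>

typedef maya = "{S :: int set. finite (S - {..<0}) \<and> finite ({..<0} - S)}"
  morphisms occ Maya
  by (rule exI[of _ "{..<0}"]) simp

setup_lifting type_definition_maya

lift_definition sea :: maya is "{..<0}"
  by simp

lift_definition fill :: "int \<Rightarrow> maya \<Rightarrow> maya" is "insert"
proof -
  fix i :: int and S :: "int set"
  assume "finite (S - {..<0}) \<and> finite ({..<0} - S)"
  moreover have "insert i S - {..<0} \<subseteq> insert i (S - {..<0})" "{..<0} - insert i S \<subseteq> {..<0} - S"
    by auto
  ultimately show "finite (insert i S - {..<0}) \<and> finite ({..<0} - insert i S)"
    by (meson finite_insert finite_subset)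
qed

lift_definition vacate :: "int \<Rightarrow> maya \<Rightarrow> maya" is "\<lambda>i S. S - {i}"
proof -
  fix i :: int and S :: "int set"
  assume "finite (S - {..<0}) \<and> finite ({..<0} - S)"
  moreover have "S - {i} - {..<0} \<subseteq> S - {..<0}" "{..<0} - (S - {i}) \<subseteq> insert i ({..<0} - S)"
    by auto
  ultimately show "finite (S - {i} - {..<0}) \<and> finite ({..<0} - (S - {i}))"
    by (meson finite_insert finite_subset)
qed

text \<open>
  A vector is the family of its coordinates in the basis of states, with no restriction on the
  support: \<open>v S\<close> is the coefficient of
  \<open>\<psi>\<^bsub>s1\<^esub> \<psi>\<^bsub>s2\<^esub> \<psi>\<^bsub>s3\<^esub> \<dots>\<close>, where \<open>s1 > s2 > s3 > \<dots>\<close> are the elements of \<open>occ S\<close>. Infinite sums,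
  exponentials and integrals of operators are therefore taken coordinatewise.
\<close>

type_synonym fock = "maya \<Rightarrow> complex"

definition parity :: "int \<Rightarrow> maya \<Rightarrow> complex" where
  "parity i S = (-1) ^ card {j \<in> occ S. i < j}"

definition psi :: "int \<Rightarrow> fock \<Rightarrow> fock" where
  "psi i v = (\<lambda>S. if i \<in> occ S then parity i S * v (vacate i S) else 0)"

definition psid :: "int \<Rightarrow> fock \<Rightarrow> fock" where
  "psid i v = (\<lambda>S. if i \<notin> occ S then parity i S * v (fill i S) else 0)"

definition ket0 :: fock where
  "ket0 = (\<lambda>S. if S = sea then 1 else 0)"

primrec bra :: "nat \<Rightarrow> fock \<Rightarrow> complex" where
  "bra 0 v = v sea"
| "bra (Suc N) v = bra N (psid (int N) v)"

definition alpha :: "nat \<Rightarrow> fock \<Rightarrow> fock" where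
  "alpha m v = (\<lambda>S. \<Sum>\<^sub>\<infinity>i. psi i (psid (i + int m) v) S)"

definition op_exp :: "(fock \<Rightarrow> fock) \<Rightarrow> fock \<Rightarrow> fock" where
  "op_exp X v = (\<lambda>S. \<Sum>\<^sub>\<infinity>k. (X ^^ k) v S / fact k)"

definition Gamma_op :: "(nat \<Rightarrow> complex) \<Rightarrow> fock \<Rightarrow> fock" where
  "Gamma_op p = op_exp (\<lambda>v S. \<Sum>\<^sub>\<infinity>m\<in>{1..}. p m / of_nat m * alpha m v S)"

definition psi_field :: "complex \<Rightarrow> fock \<Rightarrow> fock" where
  "psi_field z v = (\<lambda>S. \<Sum>\<^sub>\<infinity>i. psi i v S * z powi i)"

definition pair_contour :: "fock \<Rightarrow> fock" where
  "pair_contour v = (\<lambda>S. 1 / (4 * complex_of_real pi * \<i>) *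
     contour_integral (circlepath 0 1)
       (\<lambda>x. psi_field (inverse x) (psi_field x v) S * (x - inverse x) / x))"

definition pair_sum :: "fock \<Rightarrow> fock" where
  "pair_sum v = (\<lambda>S. \<Sum>\<^sub>\<infinity>i. psi i (psi (i - 1) v) S)"

text \<open>
  The integral over the symplectic group of rank \<open>n\<close> in terms of the eigenvalue angles.
  It has total mass \<open>1\<close>: the angles are ordered, which absorbs the order \<open>n!\<close> of the group
  permuting them. On the fermionic side the same factor is already contained in the
  exponential of a charge two operator \<open>X\<close>, whose part of charge \<open>2 * n\<close> is \<open>X ^^ n\<close> divided by
  \<open>fact n\<close>: for \<open>p = 0\<close> both sides are \<open>1\<close>, so no further \<open>1 / fact n\<close> can appear between them.
\<close>

definition sp_integral :: "nat \<Rightarrow> (nat \<Rightarrow> complex) \<Rightarrow> complex" where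
  "sp_integral n p = 2 ^ (n\<^sup>2) / complex_of_real pi ^ n *
     (LINT \<theta> : {\<theta> \<in> {1..n} \<rightarrow>\<^sub>E {0..pi}. mono_on {1..n} \<theta>} | PiM {1..n} (\<lambda>_. lborel).
        (\<Prod>j\<in>{1..n}. \<Prod>i\<in>{1..<j}. complex_of_real ((cos (\<theta> i) - cos (\<theta> j))\<^sup>2)) *
        (\<Prod>i\<in>{1..n}. exp (2 * (\<Sum>\<^sub>\<infinity>m\<in>{1..}. p m / of_nat m * complex_of_real (cos (real m * \<theta> i)))) *
           complex_of_real ((sin (\<theta> i))\<^sup>2)))"

text \<open>The anticommutation relations and the vacuum conditions.\<close>

lemma occ_fill [simp]: "occ (fill i S) = insert i (occ S)"
  by (rule fill.rep_eq)

lemma occ_vacate [simp]: "occ (vacate i S) = occ S - {i}"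
  by (rule vacate.rep_eq)

lemma occ_sea [simp]: "occ sea = {..<0}"
  by (rule sea.rep_eq)

lemma finite_above: "finite {j \<in> occ S. i < j}"
proof -
  have "finite (occ S - {..<0})"
    using occ[of S] by simp
  moreover have "{j \<in> occ S. i < j} \<subseteq> (occ S - {..<0}) \<union> {i..0}"
    by auto
  ultimately show ?thesis
    by (meson finite_Un finite_atLeastAtMost_int finite_subset)
qed

lemma parity_sq [simp]: "parity i S * parity i S = 1" "parity i S * (parity i S * x) = x"
proof -
  show "parity i S * parity i S = 1"
    by (simp add: parity_def flip: power_mult_distrib)
  then show "parity i S * (parity i S * x) = x"
    by (metis mult.assoc mult_1)
qed

lemma parity_vacate:
  "parity i (vacate j S) = (if j \<in> occ S \<and> i < j then - parity i S else parity i S)"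
proof (cases "j \<in> occ S \<and> i < j")
  case True
  have "{k \<in> occ S. i < k} = insert j {k \<in> occ (vacate j S). i < k}"
    using True by auto
  then have "card {k \<in> occ S. i < k} = Suc (card {k \<in> occ (vacate j S). i < k})"
    using finite_above[of "vacate j S" i] by simp
  then show ?thesis
    using True by (simp add: parity_def)
next
  case False
  then have "{k \<in> occ (vacate j S). i < k} = {k \<in> occ S. i < k}"
    by auto
  then show ?thesis
    using False by (simp add: parity_def)
qed

lemma parity_fill:
  "parity i (fill j S) = (if j \<notin> occ S \<and> i < j then - parity i S else parity i S)"
proof (cases "j \<in> occ S")
  case True
  then have "insert j (occ S) = occ S"
    by auto
  then show ?thesis
    using True by (simp add: parity_def)
next
  case False
  then have "vacate j (fill j S) = S"
    by (subst occ_inject[symmetric]) auto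
  then show ?thesis
    using parity_vacate[of i j "fill j S"] False by (auto split: if_splits)
qed

lemma vacate_fill: "i \<notin> occ S \<Longrightarrow> vacate i (fill i S) = S"
  by (subst occ_inject[symmetric]) auto

lemma fill_vacate: "i \<in> occ S \<Longrightarrow> fill i (vacate i S) = S"
  by (subst occ_inject[symmetric]) auto

lemma vacate_commute: "vacate i (vacate j S) = vacate j (vacate i S)"
  by (subst occ_inject[symmetric]) auto

lemma fill_commute: "fill i (fill j S) = fill j (fill i S)"
  by (subst occ_inject[symmetric]) auto

lemma fill_vacate_commute: "i \<noteq> j \<Longrightarrow> fill i (vacate j S) = vacate j (fill i S)"
  by (subst occ_inject[symmetric]) auto

lemma psi_psi: "psi i (psi j v) S + psi j (psi i v) S = 0"
proof (cases "i = j")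
  case True
  then show ?thesis
    by (simp add: psi_def)
next
  case False
  have "vacate i (vacate j S) = vacate j (vacate i S)"
    by (rule vacate_commute)
  with False show ?thesis
    by (simp add: psi_def parity_vacate)
qed

lemma psid_psid: "psid i (psid j v) S + psid j (psid i v) S = 0"
proof (cases "i = j")
  case True
  then show ?thesis
    by (simp add: psid_def)
next
  case False
  have "fill i (fill j S) = fill j (fill i S)"
    by (rule fill_commute)
  with False show ?thesis
    by (simp add: psid_def parity_fill)
qed

lemma psi_psid: "psi i (psid j v) S + psid j (psi i v) S = (if i = j then v S else 0)"
proof (cases "i = j")
  case True
  then show ?thesis
    by (simp add: psi_def psid_def parity_vacate parity_fill fill_vacate vacate_fill)
next
  case False
  have "fill j (vacate i S) = vacate i (fill j S)"
    using False by (intro fill_vacate_commute) simp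
  with False show ?thesis
    by (simp add: psi_def psid_def parity_vacate parity_fill)
qed

lemma psi_ket0: "i < 0 \<Longrightarrow> psi i ket0 S = 0" "i < 0 \<Longrightarrow> psid (-1 - i) ket0 S = 0"
proof -
  assume i: "i < 0"
  have "i \<in> occ sea" "-1 - i \<notin> occ sea"
    using i by simp_all
  moreover have "i \<notin> occ (vacate i S)" "-1 - i \<in> occ (fill (-1 - i) S)"
    by simp_all
  ultimately have "vacate i S \<noteq> sea" "fill (-1 - i) S \<noteq> sea"
    by metis+
  then show "psi i ket0 S = 0" "psid (-1 - i) ket0 S = 0"
    by (simp_all add: psi_def psid_def ket0_def)
qed

lemma bra_0: "i < 0 \<Longrightarrow> bra 0 (psi (-1 - i) v) = 0" "i < 0 \<Longrightarrow> bra 0 (psid i v) = 0"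
  "bra 0 ket0 = 1"
  by (auto simp: psi_def psid_def ket0_def)

end

theory Submission
  imports Defs
begin

text \<open>
  Products of fields \<open>\<psi>(z\<^sub>1) \<dots> \<psi>(z\<^sub>N)\<close> applied to the vacuum are eigenvectors of every \<open>\<alpha>\<^sub>m\<close>, with
  eigenvalue \<open>z\<^sub>1\<^sup>m + \<dots> + z\<^sub>N\<^sup>m\<close>, and their pairing with \<open>\<langle>N|\<close> is the Vandermonde product. Over vectors
  with a filled Dirac sea both pair operators agree, and they are the integral over \<open>t \<in> [0, \<pi>]\<close> of
  \<open>\<psi>(x\<^sup>-\<^sup>1) \<psi>(x)\<close> at \<open>x = cis t\<close> against \<open>(\<i> / \<pi>) sin t\<close>. Hence the part of charge \<open>2 n\<close> of the
  exponential is an integral over \<open>[0, \<pi>]\<^sup>n\<close> of field products, on which \<open>\<Gamma>(p)\<close> acts by a scalar under the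
  integral sign. The Vandermonde product at the points \<open>cis (\<plusminus> \<theta>\<^sub>j)\<close> is the squared product of cosine
  differences times a product of sines. The resulting integrand is symmetric and vanishes where two angles
  coincide, so the integral over the cube is \<open>n!\<close> times the integral over the ordered chamber.
\<close>

section \<open>Vectors over a filled Dirac sea\<close>

text \<open>Operator sums are taken coordinatewise, and an unordered sum that diverges has value 0,
  so the usual algebra of fields fails on arbitrary vectors. Starting from \<open>ket0\<close>,
  however, no hole ever appears in the sea: all vectors below live on states with a filled sea,
  where the coordinate at \<open>S\<close> involves only the finitely many particles of
  \<open>S\<close>, and every operator sum over levels is finite. The infinite sums that remain,
  over \<open>m\<close> in the exponent and over the degree in the exponential, are numerical: at
  points of the unit circle the eigenvalue of \<alpha>_m is bounded by the number of points, so
  summability of \<open>norm (p m) / m\<close> dominates both.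

  The exponential of the pair operator has components of every even charge, while an integral over
  \<open>n\<close> angles describes only charge \<open>2 * n\<close>. The statements about \<Gamma>
  are therefore made at states of one sector, which each \<alpha>_m preserves.

  The contour is never parametrised: the contour integral and the integral over the half circle are
  each evaluated exponent by exponent and compared with \<open>pair_sum\<close>.\<close>

definition filled :: "maya set" where
  "filled = {S. {..<0} \<subseteq> occ S}"

definition particles :: "maya \<Rightarrow> int set" where
  "particles S = {i \<in> occ S. 0 \<le> i}"

definition sector :: "nat \<Rightarrow> maya set" where
  "sector N = {S \<in> filled. card (particles S) = N}"

definition vanishes_off :: "maya set \<Rightarrow> fock \<Rightarrow> bool" where
  "vanishes_off A v \<longleftrightarrow> (\<forall>S. S \<notin> A \<longrightarrow> v S = 0)"

lemma finite_particles [simp]: "finite (particles S)"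
proof -
  have "particles S = {j \<in> occ S. -1 < j}"
    by (auto simp: particles_def)
  then show ?thesis
    using finite_above by simp
qed

lemma particles_nonneg: "i \<in> particles S \<Longrightarrow> 0 \<le> i"
  by (simp add: particles_def)

lemma particles_vacate [simp]: "particles (vacate i S) = particles S - {i}"
  by (auto simp: particles_def)

lemma particles_fill: "particles (fill i S) = (if 0 \<le> i then insert i (particles S) else particles S)"
  by (auto simp: particles_def)

lemma particles_sea [simp]: "particles sea = {}"
  by (auto simp: particles_def)

lemma sector_subset_filled: "sector N \<subseteq> filled"
  by (auto simp: sector_def)

lemma vanishes_off_mono: "vanishes_off A v \<Longrightarrow> A \<subseteq> B \<Longrightarrow> vanishes_off B v"
  by (auto simp: vanishes_off_def)

lemma vanishes_off_sector_filled: "vanishes_off (sector N) v \<Longrightarrow> vanishes_off filled v"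
  by (rule vanishes_off_mono[OF _ sector_subset_filled])

lemma vanishes_off_ket0: "vanishes_off (sector 0) ket0"
  by (auto simp: vanishes_off_def ket0_def sector_def filled_def)

text \<open>The coordinate of \<open>psi i v\<close> at \<open>S\<close> reads \<open>v\<close> at
  \<open>vacate i S\<close>. Removing a negative level would leave a hole, so only particles
  contribute.\<close>

lemma vacate_filledD:
  assumes "i \<in> occ S" "vacate i S \<in> filled"
  shows "i \<in> particles S" "S \<in> filled"
proof -
  have "i \<notin> {..<0}"
    using assms by (auto simp: filled_def)
  then show "i \<in> particles S" "S \<in> filled"
    using assms by (auto simp: filled_def particles_def)
qed

lemma vacate_sectorD:
  assumes "i \<in> occ S" "vacate i S \<in> sector N"
  shows "S \<in> sector (Suc N)"
proof -
  have "i \<in> particles S" "S \<in> filled"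
    using vacate_filledD assms by (auto simp: sector_def)
  moreover have "card (particles S - {i}) = N"
    using assms by (simp add: sector_def)
  ultimately show ?thesis
    by (simp add: sector_def card_Diff_singleton)
      (metis Suc_pred card_gt_0_iff empty_iff finite_particles)
qed

lemma psi_eq_0:
  assumes "vanishes_off filled v" "i \<notin> particles S"
  shows "psi i v S = 0"
  using assms vacate_filledD(1)[of i S] by (auto simp: psi_def vanishes_off_def)

lemma vanishes_off_psi_filled:
  assumes "vanishes_off filled v"
  shows "vanishes_off filled (psi i v)"
  using assms vacate_filledD(2) by (auto simp: psi_def vanishes_off_def)

lemma vanishes_off_psi_sector:
  assumes "vanishes_off (sector N) v"
  shows "vanishes_off (sector (Suc N)) (psi i v)"
  using assms vacate_sectorD by (auto simp: psi_def vanishes_off_def)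

text \<open>The index set is any finite set of nonnegative levels containing the particles: states
  such as \<open>vacate i S\<close> and \<open>fill i S\<close> must later be expanded over one
  common set. Nonnegativity turns \<open>powi\<close> into an ordinary power.\<close>

lemma psi_field_eq_sum:
  assumes v: "vanishes_off filled v" and J: "finite J" "particles S \<subseteq> J" "J \<subseteq> {0..}"
  shows "psi_field z v S = (\<Sum>i\<in>J. psi i v S * z ^ nat i)"
proof -
  have "psi_field z v S = (\<Sum>\<^sub>\<infinity>i\<in>J. psi i v S * z ^ nat i)"
    unfolding psi_field_def
    using J psi_eq_0[OF v] by (intro infsum_cong_neutral) (auto simp: power_int_def)
  then show ?thesis
    using J(1) by simp
qed

lemma vanishes_off_psi_field_filled:
  assumes "vanishes_off filled v"
  shows "vanishes_off filled (psi_field z v)"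
  using vanishes_off_psi_filled[OF assms]
  by (auto simp: vanishes_off_def psi_field_def)

lemma vanishes_off_psi_field_sector:
  assumes "vanishes_off (sector N) v"
  shows "vanishes_off (sector (Suc N)) (psi_field z v)"
  using vanishes_off_psi_sector[OF assms]
  by (auto simp: vanishes_off_def psi_field_def)

lemma psi_psi_field:
  assumes v: "vanishes_off filled v" and J: "finite J" "particles S \<subseteq> J" "J \<subseteq> {0..}"
  shows "psi i (psi_field z v) S = (\<Sum>j\<in>J. psi i (psi j v) S * z ^ nat j)"
proof -
  have "particles (vacate i S) \<subseteq> J"
    using J(2) by auto
  then show ?thesis
    using psi_field_eq_sum[OF v J(1) _ J(3), of "vacate i S" z]
    by (auto simp: psi_def[of i] sum_distrib_left mult.assoc)
qed

text \<open>Here the expansion happens at \<open>fill i S\<close>, which may have \<open>i\<close>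
  as an additional particle, so \<open>J\<close> has to contain it.\<close>

lemma psid_psi_field:
  assumes v: "vanishes_off filled v" and J: "finite J" "insert i (particles S) \<subseteq> J" "J \<subseteq> {0..}"
  shows "psid i (psi_field z v) S = (\<Sum>j\<in>J. psid i (psi j v) S * z ^ nat j)"
proof -
  have "particles (fill i S) \<subseteq> J"
    using J(2) by (auto simp: particles_fill)
  then show ?thesis
    using psi_field_eq_sum[OF v J(1) _ J(3), of "fill i S" z]
    by (auto simp: psid_def[of i] sum_distrib_left mult.assoc)
qed

lemma psi_field_psi_field:
  assumes v: "vanishes_off filled v"
  shows "psi_field z (psi_field w v) S
    = (\<Sum>i\<in>particles S. \<Sum>j\<in>particles S. psi i (psi j v) S * z ^ nat i * w ^ nat j)"
proof -
  have P: "particles S \<subseteq> {0..}"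
    by (auto simp: particles_def)
  have "psi i (psi_field w v) S * z ^ nat i
      = (\<Sum>j\<in>particles S. psi i (psi j v) S * z ^ nat i * w ^ nat j)" for i
    using P by (simp add: psi_psi_field[OF v, of "particles S"] sum_distrib_left mult_ac)
  then show ?thesis
    using P by (simp add: psi_field_eq_sum[OF vanishes_off_psi_field_filled[OF v], of "particles S"])
qed

lemma psi_field_anticommute:
  assumes v: "vanishes_off filled v"
  shows "psi_field z (psi_field w v) S = - psi_field w (psi_field z v) S"
proof -
  have "psi_field z (psi_field w v) S =
    (\<Sum>j\<in>particles S. \<Sum>i\<in>particles S. psi i (psi j v) S * z ^ nat i * w ^ nat j)"
    unfolding psi_field_psi_field[OF v] by (rule sum.swap)
  also have "\<dots> = (\<Sum>j\<in>particles S. \<Sum>i\<in>particles S. - (psi j (psi i v) S * w ^ nat j * z ^ nat i))"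
  proof (intro sum.cong refl)
    fix i j
    have "psi i (psi j v) S = - psi j (psi i v) S"
      using psi_psi[of i j v S] by (simp add: eq_neg_iff_add_eq_0)
    then show "psi i (psi j v) S * z ^ nat i * w ^ nat j = - (psi j (psi i v) S * w ^ nat j * z ^ nat i)"
      by simp
  qed
  finally show ?thesis
    by (simp add: psi_field_psi_field[OF v] sum_negf)
qed

section \<open>The operators \<open>\<alpha>\<^sub>m\<close>\<close>

text \<open>As \<open>m\<close> is positive, level \<open>i\<close> stays empty after the shift; a
  negative \<open>i\<close> would thus be a hole in the sea.\<close>

lemma shift_filledD:
  assumes "m \<ge> 1" "i \<in> occ S" "i + int m \<notin> occ S" "fill (i + int m) (vacate i S) \<in> filled"
  shows "i \<in> particles S" "S \<in> filled"
proof -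
  have "i \<notin> occ (fill (i + int m) (vacate i S))"
    using assms(1) by simp
  then have i: "0 \<le> i"
    using assms(4) by (force simp: filled_def)
  then show "i \<in> particles S" "S \<in> filled"
    using assms by (auto simp: filled_def particles_def)
qed

text \<open>Conservation of charge: \<alpha>_m at a state of a sector reads only coordinates of the
  same sector.\<close>

lemma shift_sector:
  assumes "i \<in> particles S" "i + int m \<notin> occ S" "S \<in> sector N"
  shows "fill (i + int m) (vacate i S) \<in> sector N"
proof -
  have i: "0 \<le> i" "i \<in> occ S"
    using assms(1) by (auto simp: particles_def)
  have "i + int m \<notin> particles S"
    using assms(2) by (simp add: particles_def)
  then have "card (insert (i + int m) (particles S - {i})) = Suc (card (particles S - {i}))"
    by (intro card_insert_disjoint) auto
  also have "\<dots> = card (particles S)"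
    using assms(1) by (intro card.remove[symmetric]) auto
  finally have "card (insert (i + int m) (particles S - {i})) = card (particles S)" .
  then show ?thesis
    using assms i by (auto simp: sector_def particles_fill filled_def)
qed

lemma psi_psid_eq_0:
  assumes "m \<ge> 1" "vanishes_off filled v" "i \<notin> particles S \<or> S \<notin> filled"
  shows "psi i (psid (i + int m) v) S = 0"
  using assms shift_filledD[of m i S] by (auto simp: psi_def psid_def vanishes_off_def)

lemma alpha_eq_sum:
  assumes m: "m \<ge> 1" and v: "vanishes_off filled v" and J: "finite J" "particles S \<subseteq> J"
  shows "alpha m v S = (\<Sum>i\<in>J. psi i (psid (i + int m) v) S)"
proof -
  have "alpha m v S = (\<Sum>\<^sub>\<infinity>i\<in>J. psi i (psid (i + int m) v) S)"
    unfolding alpha_def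
    using J psi_psid_eq_0[OF m v] by (intro infsum_cong_neutral) auto
  then show ?thesis
    using J(1) by simp
qed

lemma vanishes_off_alpha:
  assumes "m \<ge> 1" "vanishes_off filled v"
  shows "vanishes_off filled (alpha m v)"
  using psi_psid_eq_0[OF assms] by (auto simp: vanishes_off_def alpha_def)

text \<open>For nonnegative \<open>i\<close> the level \<open>i + m\<close> is empty in the sea, so
  the annihilator kills the vacuum; for negative \<open>i\<close> the shift would leave a
  hole.\<close>

lemma alpha_ket0: "m \<ge> 1 \<Longrightarrow> alpha m ket0 S = 0"
proof -
  assume m: "m \<ge> 1"
  have "psi i (psid (i + int m) ket0) S = 0" for i
  proof (cases "0 \<le> i")
    case True
    have "i + int m \<in> occ (fill (i + int m) (vacate i S))"
      by simp
    then have "fill (i + int m) (vacate i S) \<noteq> sea"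
      using True by (metis add_nonneg_nonneg lessThan_iff not_le occ_sea of_nat_0_le_iff)
    then show ?thesis
      by (simp add: psi_def psid_def ket0_def)
  next
    case False
    then show ?thesis
      using psi_psid_eq_0[OF m vanishes_off_sector_filled[OF vanishes_off_ket0], of i S]
      by (auto simp: particles_def)
  qed
  then show ?thesis
    by (simp add: alpha_def)
qed

text \<open>The commutator of \<alpha>_m with \<open>psi j\<close> is \<open>psi (j - m)\<close>;
  summed against the powers of \<open>z\<close> this multiplies the field by
  \<open>z ^ m\<close>.\<close>

lemma alpha_psi_field:
  assumes m: "m \<ge> 1" and v: "vanishes_off filled v"
  shows "alpha m (psi_field z v) S = z ^ m * psi_field z v S + psi_field z (alpha m v) S"
proof -
  define P where "P = particles S"
  \<comment> \<open>The contraction pairs level \<open>i\<close> with \<open>j = i + m\<close>, so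
    the shifted particles must be available as indices too.\<close>
  define J where "J = P \<union> (\<lambda>i. i + int m) ` P"
  have P: "finite P" "P \<subseteq> {0..}"
    by (simp_all add: P_def particles_nonneg subset_iff)
  have J: "finite J" "J \<subseteq> {0..}" "P \<subseteq> J"
    using P by (auto simp: J_def)
  have "alpha m (psi_field z v) S = (\<Sum>i\<in>P. psi i (psid (i + int m) (psi_field z v)) S)"
    by (rule alpha_eq_sum[OF m vanishes_off_psi_field_filled[OF v]]) (auto simp: P_def)
  also have "\<dots> = (\<Sum>i\<in>P. \<Sum>j\<in>J. (if i + int m = j then psi i v S * z ^ nat j else 0)
      + psi j (psi i (psid (i + int m) v)) S * z ^ nat j)"
  proof (intro sum.cong refl)
    fix i assume i: "i \<in> P"
    then have iS: "i \<in> occ S"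
      by (simp add: P_def particles_def)
    have "psi i (psid (i + int m) (psi_field z v)) S
        = parity i S * psid (i + int m) (psi_field z v) (vacate i S)"
      using iS by (simp add: psi_def)
    also have "psid (i + int m) (psi_field z v) (vacate i S)
        = (\<Sum>j\<in>J. psid (i + int m) (psi j v) (vacate i S) * z ^ nat j)"
      using i J by (intro psid_psi_field[OF v]) (auto simp: J_def P_def)
    also have "parity i S * \<dots> = (\<Sum>j\<in>J. psi i (psid (i + int m) (psi j v)) S * z ^ nat j)"
      using iS by (simp add: psi_def[of i] sum_distrib_left mult.assoc)
    also have "\<dots> = (\<Sum>j\<in>J. (if i + int m = j then psi i v S * z ^ nat j else 0)
        + psi j (psi i (psid (i + int m) v)) S * z ^ nat j)"
    proof (intro sum.cong refl)
      fix j
      \<comment> \<open>\<open>psi j\<close> is moved to the front past the annihilator and then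
        past \<open>psi i\<close>: the two signs cancel and only the contraction term is left
        over.\<close>
      have "psid (i + int m) (psi j v) (vacate i S)
          = (if i + int m = j then v (vacate i S) else 0) - psi j (psid (i + int m) v) (vacate i S)"
        using psi_psid[of j "i + int m" v "vacate i S"]
        by (auto simp: eq_diff_eq add.commute split: if_splits)
      then have "psi i (psid (i + int m) (psi j v)) S
          = (if i + int m = j then psi i v S else 0) - psi i (psi j (psid (i + int m) v)) S"
        using iS by (simp add: psi_def[of i] right_diff_distrib)
      moreover have "psi i (psi j (psid (i + int m) v)) S = - psi j (psi i (psid (i + int m) v)) S"
        using psi_psi[of i j _ S] by (simp add: eq_neg_iff_add_eq_0)
      ultimately show "psi i (psid (i + int m) (psi j v)) S * z ^ nat j
          = (if i + int m = j then psi i v S * z ^ nat j else 0)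
            + psi j (psi i (psid (i + int m) v)) S * z ^ nat j"
        by (simp add: algebra_simps)
    qed
    finally show "psi i (psid (i + int m) (psi_field z v)) S = \<dots>" .
  qed
  also have "\<dots> = (\<Sum>i\<in>P. \<Sum>j\<in>J. if i + int m = j then psi i v S * z ^ nat j else 0)
      + (\<Sum>i\<in>P. \<Sum>j\<in>J. psi j (psi i (psid (i + int m) v)) S * z ^ nat j)"
    by (simp add: sum.distrib)
  also have "(\<Sum>i\<in>P. \<Sum>j\<in>J. if i + int m = j then psi i v S * z ^ nat j else 0)
      = (\<Sum>i\<in>P. z ^ m * (psi i v S * z ^ nat i))"
  proof (intro sum.cong refl)
    fix i assume i: "i \<in> P"
    then have "i + int m \<in> J" "0 \<le> i"
      using P by (auto simp: J_def)
    then show "(\<Sum>j\<in>J. if i + int m = j then psi i v S * z ^ nat j else 0)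
        = z ^ m * (psi i v S * z ^ nat i)"
      using J(1) by (simp add: nat_add_distrib power_add)
  qed
  also have "\<dots> = z ^ m * psi_field z v S"
    using P by (simp add: sum_distrib_left psi_field_eq_sum[OF v, of P S] P_def)
  also have "(\<Sum>i\<in>P. \<Sum>j\<in>J. psi j (psi i (psid (i + int m) v)) S * z ^ nat j)
      = (\<Sum>j\<in>J. psi j (alpha m v) S * z ^ nat j)"
  \<comment> \<open>For fixed \<open>j\<close> the inner sum is \<open>alpha m v\<close> at
    \<open>vacate j S\<close>, whose particles still lie in \<open>P\<close>.\<close>
  proof (subst sum.swap, intro sum.cong refl)
    fix j
    show "(\<Sum>i\<in>P. psi j (psi i (psid (i + int m) v)) S * z ^ nat j) = psi j (alpha m v) S * z ^ nat j"
      using alpha_eq_sum[OF m v P(1), of "vacate j S"]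
      by (auto simp: psi_def[of j] P_def sum_distrib_left sum_distrib_right)
  qed
  also have "\<dots> = psi_field z (alpha m v) S"
    using J by (simp add: psi_field_eq_sum[OF vanishes_off_alpha[OF m v], of J S] P_def)
  finally show ?thesis .
qed

section \<open>Products of fields on the vacuum\<close>

definition field_prod :: "complex list \<Rightarrow> fock" where
  "field_prod zs = foldr psi_field zs ket0"

lemma field_prod_simps [simp]:
  "field_prod [] = ket0" "field_prod (z # zs) = psi_field z (field_prod zs)"
  by (simp_all add: field_prod_def)

lemma field_prod_sector: "vanishes_off (sector (length zs)) (field_prod zs)"
  by (induction zs) (auto intro: vanishes_off_ket0 vanishes_off_psi_field_sector)

lemmas field_prod_filled = vanishes_off_sector_filled[OF field_prod_sector]

lemma field_prod_Cons_eq_sum: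
  "field_prod (z # zs) S = (\<Sum>i\<in>particles S. psi i (field_prod zs) S * z ^ nat i)"
  by (simp add: psi_field_eq_sum[OF field_prod_filled, of "particles S"] particles_nonneg subset_iff)

lemma alpha_field_prod:
  assumes m: "m \<ge> 1"
  shows "alpha m (field_prod zs) S = (\<Sum>z\<leftarrow>zs. z ^ m) * field_prod zs S"
proof (induction zs arbitrary: S)
  case Nil
  then show ?case
    using m by (simp add: alpha_ket0)
next
  case (Cons z zs)
  have "alpha m (field_prod zs) = (\<lambda>S. (\<Sum>z\<leftarrow>zs. z ^ m) * field_prod zs S)"
    using Cons by blast
  moreover have "psi i (\<lambda>S. c * w S) S = c * psi i w S" for i c w
    by (simp add: psi_def)
  ultimately have "psi_field z (alpha m (field_prod zs)) S = (\<Sum>z\<leftarrow>zs. z ^ m) * psi_field z (field_prod zs) S"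
    using field_prod_filled[of zs]
    by (simp add: psi_field_eq_sum[of _ "particles S"] particles_nonneg subset_iff vanishes_off_def
      sum_distrib_left mult.assoc)
  then show ?case
    by (simp add: alpha_psi_field[OF m field_prod_filled] algebra_simps)
qed

text \<open>On its sector the product expands like a determinant with unimodular entries, so the
  number of terms bounds it. The bound is uniform in the points and serves as the dominating
  constant under the integrals.\<close>

lemma norm_field_prod_le:
  assumes "\<And>z. z \<in> set zs \<Longrightarrow> norm z = 1"
  shows "norm (field_prod zs S) \<le> fact (length zs)"
  using assms
proof (induction zs arbitrary: S)
  case Nil
  then show ?case
    by (simp add: ket0_def)
next
  case (Cons z zs)
  have par: "norm (parity i S) = 1" for i
    by (simp add: parity_def norm_power)
  show ?case
  proof (cases "S \<in> sector (length (z # zs))")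
    case True
    have "norm (field_prod (z # zs) S) \<le> (\<Sum>i\<in>particles S. norm (psi i (field_prod zs) S * z ^ nat i))"
      unfolding field_prod_Cons_eq_sum by (rule norm_sum)
    also have "\<dots> \<le> (\<Sum>i\<in>particles S. fact (length zs))"
      using Cons by (intro sum_mono) (auto simp: psi_def norm_mult norm_power par)
    finally show ?thesis
      using True by (simp add: sector_def)
  next
    case False
    then have "field_prod (z # zs) S = 0"
      using field_prod_sector[of "z # zs"] unfolding vanishes_off_def by blast
    then show ?thesis
      by simp
  qed
qed

section \<open>The Vandermonde evaluation\<close>

text \<open>The state whose coordinate is read by \<langle>N|.\<close>

primrec packed :: "nat \<Rightarrow> maya" where
  "packed 0 = sea"
| "packed (Suc N) = fill (int N) (packed N)"

lemma occ_packed: "occ (packed N) = {..<int N}"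
proof (induction N)
  case (Suc N)
  have "insert (int N) {..<int N} = {..<int (Suc N)}"
    unfolding set_eq_iff insert_iff lessThan_iff by presburger
  then show ?case
    using Suc by simp
qed simp

lemma particles_packed: "particles (packed N) = int ` {..<N}"
proof -
  have "particles (packed N) = {int 0..<int N}"
    by (auto simp: particles_def occ_packed)
  then show ?thesis
    unfolding image_int_atLeastLessThan[symmetric] by (simp add: atLeast0LessThan)
qed

lemma packed_sector: "packed N \<in> sector N"
  by (auto simp: sector_def filled_def occ_packed particles_packed card_image)

text \<open>No particle lies above level \<open>N\<close> in either state, so filling from the
  bottom produces no signs.\<close>

lemma parity_packed: "parity (int N) (packed N) = 1" "parity (int N) (packed (Suc N)) = 1"
proof -
  have "{j. j < int N \<and> int N < j} = {}" "{j. j < int (Suc N) \<and> int N < j} = {}"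
    by auto
  then show "parity (int N) (packed N) = 1" "parity (int N) (packed (Suc N)) = 1"
    by (simp_all only: parity_def occ_packed mem_Collect_eq lessThan_iff) simp_all
qed

lemma bra_eq_packed: "bra N v = v (packed N)"
  by (induction N arbitrary: v) (simp_all add: psid_def parity_packed occ_packed)

text \<open>Identifies the leading coefficient in the Vandermonde recursion: removing the top
  particle leaves the next smaller packed state.\<close>

lemma psi_packed: "psi (int N) v (packed (Suc N)) = v (packed N)"
proof -
  have "vacate (int N) (packed (Suc N)) = packed N"
    by (simp add: vacate_fill occ_packed)
  then show ?thesis
    using parity_packed(2)[of N] by (simp add: psi_def)
qed

lemma psi_zero: "psi i (\<lambda>S. 0) S = 0"
  by (simp add: psi_def)

lemma psi_field_zero: "psi_field z (\<lambda>S. 0) S = 0"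
  by (simp add: psi_field_def psi_zero)

text \<open>Anticommutation carries the first field up to its equal; two adjacent equal fields give
  a vector that is its own negative.\<close>

lemma field_prod_repeated:
  assumes "z \<in> set zs"
  shows "field_prod (z # zs) S = 0"
  using assms
proof (induction zs arbitrary: S)
  case (Cons w ws)
  show ?case
  proof (cases "z = w")
    case True
    then show ?thesis
      using psi_field_anticommute[OF field_prod_filled[of ws], of w w S] by simp
  next
    case False
    then have "field_prod (z # ws) = (\<lambda>S. 0)"
      using Cons by auto
    then show ?thesis
      using psi_field_anticommute[OF field_prod_filled[of ws], of z w S] by (simp add: psi_field_zero)
  qed
qed simp

lemma field_prod_not_distinct:
  assumes "\<not> distinct zs"
  shows "field_prod zs S = 0"
  using assms
proof (induction zs arbitrary: S)
  case (Cons z zs)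
  show ?case
  proof (cases "z \<in> set zs")
    case True
    then show ?thesis
      by (rule field_prod_repeated)
  next
    case False
    then have "field_prod zs = (\<lambda>S. 0)"
      using Cons by auto
    then show ?thesis
      by (simp add: psi_field_zero)
  qed
qed simp

text \<open>
  As a polynomial in \<open>z\<close> the left side has degree at most \<open>length zs\<close>, leading coefficient
  \<open>field_prod zs (packed (length zs))\<close>, and by antisymmetry it vanishes at the elements of \<open>zs\<close>.
\<close>

lemma field_prod_Cons_packed:
  "field_prod (z # zs) (packed (Suc (length zs))) = (\<Prod>w\<leftarrow>zs. z - w) * field_prod zs (packed (length zs))"
proof (cases "distinct zs")
  \<comment> \<open>With a repetition both sides vanish. Distinctness is what supplies
    \<open>length zs\<close> different roots in the other case.\<close>
  case False
  then show ?thesis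
    by (simp add: field_prod_not_distinct del: field_prod_simps)
next
  case True
  define N where "N = length zs"
  define c where "c = field_prod zs (packed N)"
  define q where "q = (\<Sum>i<Suc N. monom (psi (int i) (field_prod zs) (packed (Suc N))) i)"
  define r where "r = smult c (\<Prod>w\<leftarrow>zs. [:- w, 1:])"
  have poly_q: "poly q x = field_prod (x # zs) (packed (Suc N))" for x
    by (simp add: q_def poly_sum poly_monom field_prod_Cons_eq_sum particles_packed sum.reindex
      del: field_prod_simps packed.simps sum.lessThan_Suc)
  have poly_r: "poly r x = (\<Prod>w\<leftarrow>zs. x - w) * c" for x
    unfolding r_def by (induction zs) (auto simp: algebra_simps)
  have prod_deg: "degree (\<Prod>w\<leftarrow>zs. [:- w, 1:]) = N \<and> lead_coeff (\<Prod>w\<leftarrow>zs. [:- w, 1:]) = 1"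
    unfolding N_def
  proof (induction zs)
    case (Cons w ws)
    then have nz: "(\<Prod>w\<leftarrow>ws. [:- w, 1:]) \<noteq> 0"
      by auto
    have 1: "degree [:- w, 1:] = 1" "lead_coeff [:- w, 1:] = 1" "[:- w, 1:] \<noteq> 0"
      by simp_all
    have "degree ([:- w, 1:] * (\<Prod>w\<leftarrow>ws. [:- w, 1:])) = length (w # ws)"
      using Cons 1(1) degree_mult_eq[OF 1(3) nz] by simp
    moreover have "lead_coeff ([:- w, 1:] * (\<Prod>w\<leftarrow>ws. [:- w, 1:])) = 1"
    proof -
      have "lead_coeff (\<Prod>w\<leftarrow>ws. [:- w, 1:]) = 1"
        using Cons by blast
      then show ?thesis
        by (simp only: lead_coeff_mult 1(2) mult_1)
    qed
    ultimately show ?case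
      unfolding list.map prod_list.Cons by blast
  qed simp
  have "q = r"
  proof (rule poly_eqI_degree_lead_coeff[where n = N and A = "set zs"])
    have "coeff q N = psi (int N) (field_prod zs) (packed (Suc N))"
      by (simp add: q_def coeff_sum coeff_monom)
    moreover have "coeff (\<Prod>w\<leftarrow>zs. [:- w, 1:]) N = 1"
      using prod_deg by metis
    ultimately show "coeff q N = coeff r N"
      unfolding psi_packed r_def c_def by simp
    show "N \<le> card (set zs)"
      using True by (simp add: N_def distinct_card)
    show "degree q \<le> N"
      unfolding q_def by (intro degree_sum_le) (auto intro: order.trans[OF degree_monom_le])
    show "degree r \<le> N"
      using prod_deg unfolding r_def by simp
    fix x assume x: "x \<in> set zs"
    then have "(\<Prod>w\<leftarrow>zs. x - w) = 0"
      by (induction zs) auto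
    then show "poly q x = poly r x"
      using x by (simp add: poly_q poly_r field_prod_repeated del: field_prod_simps)
  qed
  then have "poly q z = poly r z"
    by simp
  then show ?thesis
    unfolding poly_q poly_r by (simp only: N_def c_def)
qed

section \<open>The two pair operators\<close>

lemma pair_sum_eq_sum:
  assumes v: "vanishes_off filled v" and J: "finite J" "particles S \<subseteq> J"
  shows "pair_sum v S = (\<Sum>i\<in>J. psi i (psi (i - 1) v) S)"
proof -
  have "pair_sum v S = (\<Sum>\<^sub>\<infinity>i\<in>J. psi i (psi (i - 1) v) S)"
    unfolding pair_sum_def
    using J psi_eq_0[OF vanishes_off_psi_filled[OF v]] by (intro infsum_cong_neutral) auto
  then show ?thesis
    using J(1) by simp
qed

lemma vanishes_off_pair_sum:
  assumes "vanishes_off (sector N) v"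
  shows "vanishes_off (sector (N + 2)) (pair_sum v)"
  using vanishes_off_psi_sector[OF vanishes_off_psi_sector[OF assms]]
  by (auto simp: vanishes_off_def pair_sum_def)

lemma pair_sum_pow_sector: "vanishes_off (sector (2 * k)) ((pair_sum ^^ k) ket0)"
proof (induction k)
  case (Suc k)
  then show ?case
    using vanishes_off_pair_sum[OF Suc] by simp
qed (simp add: vanishes_off_ket0)

text \<open>Antisymmetry turns the part of the sum with \<open>j = i + 1\<close> into minus the part with \<open>j = i - 1\<close>.\<close>

lemma antisym_pair_sum:
  assumes v: "vanishes_off filled v"
  shows "(\<Sum>i\<in>particles S. \<Sum>j\<in>particles S. psi i (psi j v) S *
      ((if i - j = 1 then 1 else 0) - (if i - j = -1 then 1 else 0))) = 2 * pair_sum v S"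
proof -
  define P where "P = particles S"
  have P: "finite P"
    by (simp add: P_def)
  have z: "psi i (psi j v) S = 0" if "i \<notin> P \<or> j \<notin> P" for i j
    using that psi_eq_0[OF vanishes_off_psi_filled[OF v], of i S j] psi_eq_0[OF vanishes_off_psi_filled[OF v], of j S i]
      psi_psi[of i j v S] by (auto simp: P_def)
  have 1: "(\<Sum>i\<in>P. \<Sum>j\<in>P. psi i (psi j v) S * (if i - j = 1 then 1 else 0)) = pair_sum v S"
  proof -
    have "(\<Sum>j\<in>P. psi i (psi j v) S * (if i - j = 1 then 1 else 0)) = psi i (psi (i - 1) v) S" for i
    proof -
      have "(\<Sum>j\<in>P. psi i (psi j v) S * (if i - j = 1 then 1 else 0))
          = (\<Sum>j\<in>P. if j = i - 1 then psi i (psi j v) S else 0)"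
        by (intro sum.cong) auto
      then show ?thesis
        using P z[of i "i - 1"] by auto
    qed
    then show ?thesis
      using pair_sum_eq_sum[OF v P] by (simp add: P_def)
  qed
  have "(\<Sum>i\<in>P. \<Sum>j\<in>P. psi i (psi j v) S * (if i - j = -1 then 1 else 0))
      = (\<Sum>i\<in>P. \<Sum>j\<in>P. psi j (psi i v) S * (if j - i = -1 then 1 else 0))"
    by (rule sum.swap)
  also have "\<dots> = (\<Sum>i\<in>P. \<Sum>j\<in>P. - (psi i (psi j v) S * (if i - j = 1 then 1 else 0)))"
    using psi_psi[of _ _ v S] by (intro sum.cong refl) (auto simp: eq_neg_iff_add_eq_0)
  also have "\<dots> = - pair_sum v S"
    using 1 by (simp add: sum_negf)
  finally show ?thesis
    using 1 by (simp add: P_def right_diff_distrib sum_subtractf)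
qed

section \<open>Contour integral against sum, and orthogonality of sines\<close>

lemma has_contour_integral_power_int:
  "((\<lambda>x. x powi k) has_contour_integral (if k = -1 then 2 * of_real pi * \<i> else 0)) (circlepath 0 1)"
proof (cases "k = -1")
  case True
  have "((\<lambda>w. 1 / (w - 0)) has_contour_integral 2 * of_real pi * \<i>) (circlepath 0 1)"
    using Cauchy_integral_circlepath_simple[of "\<lambda>_. 1" 0 1 0] by simp
  then show ?thesis
    using True by (simp add: power_int_minus inverse_eq_divide)
next
  case False
  have "((\<lambda>x. x powi k) has_contour_integral 0) (circlepath 0 1)"
  proof (rule Cauchy_theorem_primitive[where S = "- {0}"])
    fix x :: complex assume "x \<in> - {0}"
    then show "((\<lambda>x. x powi (k + 1) / of_int (k + 1)) has_field_derivative x powi k) (at x within - {0})"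
      using False by (auto intro!: derivative_eq_intros simp del: of_int_add)
  qed (auto simp: path_image_circlepath)
  then show ?thesis
    using False by simp
qed

text \<open>Only exponent -1 survives the contour: \<open>j = i - 1\<close> with sign plus and
  \<open>j = i + 1\<close> with sign minus. By antisymmetry the two contributions agree, and this
  doubling together with the residue factor absorbs \<open>1 / (4 * pi * \<i>)\<close>.\<close>

lemma pair_contour_eq_pair_sum:
  assumes v: "vanishes_off filled v"
  shows "pair_contour v = pair_sum v"
proof
  fix S
  define P where "P = particles S"
  have P: "finite P" "\<And>i. i \<in> P \<Longrightarrow> 0 \<le> i"
    by (simp_all add: P_def particles_nonneg)
  define h where "h = (\<lambda>i j x :: complex. psi i (psi j v) S * (x powi (j - i) - x powi (j - i - 2)))"
  define I where "I = (\<lambda>i j. psi i (psi j v) S *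
    ((if j - i = -1 then 2 * of_real pi * \<i> else 0) - (if j - i - 2 = -1 then 2 * of_real pi * \<i> else 0)))"
  have eq: "psi_field (inverse x) (psi_field x v) S * (x - inverse x) / x = (\<Sum>i\<in>P. \<Sum>j\<in>P. h i j x)"
    if "x \<in> path_image (circlepath 0 1)" for x
  proof -
    have x: "x \<noteq> 0"
      using that by (auto simp: path_image_circlepath)
    have "inverse x ^ nat i * x ^ nat j * (x - inverse x) / x = x powi (j - i) - x powi (j - i - 2)"
      if "i \<in> P" "j \<in> P" for i j
    proof -
      have "x powi (j - i) = x ^ nat j * inverse x ^ nat i"
      proof -
        have "x powi i = x ^ nat i" "x powi j = x ^ nat j"
          using P(2) that by (simp_all add: power_int_def)
        then show ?thesis
          using x by (simp add: power_int_diff power_inverse divide_inverse)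
      qed
      moreover have "x powi (j - i - 2) = x powi (j - i) / x\<^sup>2"
        using x by (simp add: power_int_diff)
      ultimately show ?thesis
        using x by (simp add: right_diff_distrib diff_divide_distrib) (simp add: field_simps power2_eq_square)
    qed
    then show ?thesis
      unfolding psi_field_psi_field[OF v] h_def P_def[symmetric] sum_distrib_right sum_divide_distrib
      by (intro sum.cong refl) (simp add: mult.assoc flip: times_divide_eq_right)
  qed
  have "((\<lambda>x. \<Sum>i\<in>P. \<Sum>j\<in>P. h i j x) has_contour_integral (\<Sum>i\<in>P. \<Sum>j\<in>P. I i j)) (circlepath 0 1)"
    unfolding h_def I_def using P(1)
    by (intro has_contour_integral_sum has_contour_integral_lmul has_contour_integral_diff
      has_contour_integral_power_int)
  then have "contour_integral (circlepath 0 1)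
      (\<lambda>x. psi_field (inverse x) (psi_field x v) S * (x - inverse x) / x) = (\<Sum>i\<in>P. \<Sum>j\<in>P. I i j)"
    by (intro contour_integral_unique) (erule has_contour_integral_eq, simp add: eq)
  also have "\<dots> = (\<Sum>i\<in>P. \<Sum>j\<in>P. 2 * of_real pi * \<i> * (psi i (psi j v) S *
      ((if i - j = 1 then 1 else 0) - (if i - j = -1 then 1 else 0))))"
    unfolding I_def by (intro sum.cong refl) auto
  also have "\<dots> = 2 * of_real pi * \<i> * (2 * pair_sum v S)"
    unfolding antisym_pair_sum[OF v, symmetric] P_def by (simp add: sum_distrib_left)
  finally show "pair_contour v S = pair_sum v S"
    by (simp add: pair_contour_def)
qed

text \<open>The two operators are known to agree only over a filled sea, so they are compared along
  the iterates of \<open>ket0\<close>, which stay there.\<close>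

lemma op_exp_pair_contour_ket0: "op_exp pair_contour ket0 = op_exp pair_sum ket0"
proof -
  have "(pair_contour ^^ k) ket0 = (pair_sum ^^ k) ket0" for k
    using pair_contour_eq_pair_sum[OF vanishes_off_sector_filled[OF pair_sum_pow_sector]]
    by (induction k) auto
  then show ?thesis
    by (simp add: op_exp_def)
qed

text \<open>The frequency is a difference of two levels and so may be negative or zero; the value is
  written as a difference of two indicators to fit \<open>antisym_pair_sum\<close>.\<close>

lemma has_integral_sin_mult_sin:
  fixes k :: int
  shows "((\<lambda>t. sin t * sin (of_int k * t)) has_integral
    pi / 2 * ((if k = 1 then 1 else 0) - (if k = -1 then 1 else 0))) {0..pi}"
proof -
  have *: "((\<lambda>t. cos (of_int l * t)) has_integral (if l = 0 then pi else 0)) {0..pi}" for l :: int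
  proof (cases "l = 0")
    case True
    then show ?thesis
      using has_integral_const_real[of "1 :: real" 0 pi] by simp
  next
    case False
    have "((\<lambda>t. cos (of_int l * t)) has_integral (sin (of_int l * pi) / of_int l - sin (of_int l * 0) / of_int l)) {0..pi}"
      using False by (intro fundamental_theorem_of_calculus)
        (auto intro!: derivative_eq_intros simp flip: has_real_derivative_iff_has_vector_derivative)
    then show ?thesis
      using False by (simp add: sin_int_times_real mult.commute[of _ pi] sin_integer_2pi sin_zero_iff_int2)
  qed
  have "((\<lambda>t. (cos (of_int (k - 1) * t) - cos (of_int (k + 1) * t)) / 2) has_integral
      ((if k - 1 = 0 then pi else 0) - (if k + 1 = 0 then pi else 0)) / 2) {0..pi}"
    by (intro has_integral_divide has_integral_diff *)
  moreover have "(cos (of_int (k - 1) * t) - cos (of_int (k + 1) * t)) / 2 = sin t * sin (of_int k * t)" for t :: real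
    by (simp add: left_diff_distrib distrib_right cos_add cos_diff)
  ultimately show ?thesis
    by (simp add: if_distrib cong: if_cong) (auto simp: add_eq_0_iff split: if_splits)
qed

section \<open>Operators under the integral sign\<close>

text \<open>Passage from the unordered sums of the definitions to ordinary series, for which
  termwise integration is available.\<close>

lemma complex_infsum_eq_suminf:
  fixes f :: "nat \<Rightarrow> complex"
  assumes "\<And>m. m \<in> I \<Longrightarrow> norm (f m) \<le> B m" "B summable_on I"
  shows "(\<Sum>\<^sub>\<infinity>m\<in>I. f m) = (\<Sum>m. if m \<in> I then f m else 0)"
    and "summable (\<lambda>m. norm (if m \<in> I then f m else 0))"
proof -
  let ?f = "\<lambda>m. if m \<in> I then f m else 0"
  have abs: "(\<lambda>m. norm (f m)) summable_on I"
    using Infinite_Sum.abs_summable_on_comparison_test'[OF assms(2,1)] by simp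
  have "(\<lambda>m. norm (?f m)) summable_on UNIV"
    using abs by (rule summable_on_cong_neutral[THEN iffD1, rotated -1]) auto
  then show "summable (\<lambda>m. norm (?f m))"
    by (rule summable_on_imp_summable)
  have "(f has_sum (\<Sum>\<^sub>\<infinity>m\<in>I. f m)) I"
    using abs_summable_summable[OF abs] by (rule has_sum_infsum)
  then have "(?f has_sum (\<Sum>\<^sub>\<infinity>m\<in>I. f m)) UNIV"
    by (rule has_sum_cong_neutral[THEN iffD1, rotated -1]) auto
  then show "(\<Sum>\<^sub>\<infinity>m\<in>I. f m) = (\<Sum>m. ?f m)"
    by (metis has_sum_imp_sums sums_unique)
qed

text \<open>The integrals of the norms are at most \<open>B m\<close> times the L1 norm of
  \<open>h\<close>, hence summable. The exchange is applied both to the sum over \<open>m\<close> in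
  the exponent and to the exponential series.\<close>

lemma
  fixes b :: "nat \<Rightarrow> 'a \<Rightarrow> complex"
  assumes h: "integrable M h"
    and b [measurable]: "\<And>m. m \<in> I \<Longrightarrow> b m \<in> borel_measurable M"
    and bound: "\<And>m x. m \<in> I \<Longrightarrow> norm (b m x) \<le> B m" and B: "B summable_on I"
  shows integral_mult_infsum: "(\<integral>x. h x * (\<Sum>\<^sub>\<infinity>m\<in>I. b m x) \<partial>M) = (\<Sum>\<^sub>\<infinity>m\<in>I. \<integral>x. h x * b m x \<partial>M)"
    and borel_measurable_infsum: "(\<lambda>x. \<Sum>\<^sub>\<infinity>m\<in>I. b m x) \<in> borel_measurable M"
proof -
  define b' where "b' = (\<lambda>m x. if m \<in> I then b m x else 0)"
  define B' where "B' = (\<lambda>m. if m \<in> I then B m else 0)"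
  have b' [measurable]: "b' m \<in> borel_measurable M" for m
    by (cases "m \<in> I") (auto simp: b'_def)
  have h_meas [measurable]: "h \<in> borel_measurable M"
    using h by auto
  have infsum_b: "(\<Sum>\<^sub>\<infinity>m\<in>I. b m x) = (\<Sum>m. b' m x)" for x
    using complex_infsum_eq_suminf(1)[OF bound B] by (simp add: b'_def)
  show "(\<lambda>x. \<Sum>\<^sub>\<infinity>m\<in>I. b m x) \<in> borel_measurable M"
    unfolding infsum_b by measurable
  have B_nonneg: "0 \<le> B m" if "m \<in> I" for m
    using bound[OF that] norm_ge_zero order.trans by blast
  have norm_b': "norm (b' m x) \<le> B' m" for m x
    using bound by (auto simp: b'_def B'_def)
  have B'_nonneg: "0 \<le> B' m" for m
    using B_nonneg by (simp add: B'_def)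
  have sum_B': "summable B'"
  proof (rule summable_on_imp_summable)
    show "B' summable_on UNIV"
      using B by (rule summable_on_cong_neutral[THEN iffD1, rotated -1]) (auto simp: B'_def)
  qed
  have sum_b': "summable (\<lambda>m. norm (b' m x))" for x
    by (rule summable_comparison_test'[OF sum_B', of 0]) (simp add: norm_b')
  have int: "integrable M (\<lambda>x. h x * b' m x)" for m
  proof (rule Bochner_Integration.integrable_bound)
    show "integrable M (\<lambda>x. B' m *\<^sub>R h x)"
      using h by simp
    show "AE x in M. norm (h x * b' m x) \<le> norm (B' m *\<^sub>R h x)"
      using mult_right_mono[OF norm_b'[of m] norm_ge_zero[of "h _"]] B'_nonneg[of m]
      by (intro AE_I2) (simp add: norm_mult mult.commute)
  qed measurable
  have norm_int: "(\<integral>x. norm (h x * b' m x) \<partial>M) \<le> B' m * (\<integral>x. norm (h x) \<partial>M)" for m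
  proof -
    have "(\<integral>x. norm (h x * b' m x) \<partial>M) \<le> (\<integral>x. B' m * norm (h x) \<partial>M)"
    proof (rule integral_mono)
      show "integrable M (\<lambda>x. norm (h x * b' m x))" "integrable M (\<lambda>x. B' m * norm (h x))"
        using int h by auto
      show "norm (h x * b' m x) \<le> B' m * norm (h x)" for x
        using mult_right_mono[OF norm_b'[of m x] norm_ge_zero[of "h x"]]
        by (simp add: norm_mult mult.commute)
    qed
    then show ?thesis
      by simp
  qed
  have "summable (\<lambda>m. \<integral>x. norm (h x * b' m x) \<partial>M)"
  proof (rule summable_comparison_test'[where N = 0])
    show "summable (\<lambda>m. B' m * (\<integral>x. norm (h x) \<partial>M))"
      using sum_B' by (rule summable_mult2)
    show "norm (\<integral>x. norm (h x * b' m x) \<partial>M) \<le> B' m * (\<integral>x. norm (h x) \<partial>M)" for m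
      using norm_int[of m] by simp
  qed
  moreover have "AE x in M. summable (\<lambda>m. norm (h x * b' m x))"
    using sum_b' by (intro AE_I2) (simp add: norm_mult summable_mult)
  ultimately have "(\<integral>x. (\<Sum>m. h x * b' m x) \<partial>M) = (\<Sum>m. \<integral>x. h x * b' m x \<partial>M)"
    using int by (intro integral_suminf) auto
  moreover have "(\<Sum>m. h x * b' m x) = h x * (\<Sum>m. b' m x)" for x
    using sum_b'[of x] by (intro suminf_mult) (rule summable_norm_cancel)
  moreover have "(\<Sum>m. \<integral>x. h x * b' m x \<partial>M) = (\<Sum>\<^sub>\<infinity>m\<in>I. \<integral>x. h x * b m x \<partial>M)"
  proof -
    have "norm (\<integral>x. h x * b m x \<partial>M) \<le> B m * (\<integral>x. norm (h x) \<partial>M)" if "m \<in> I" for m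
      using order.trans[OF integral_norm_bound norm_int[of m]] that by (simp add: b'_def B'_def)
    moreover have "(\<lambda>m. B m * (\<integral>x. norm (h x) \<partial>M)) summable_on I"
      by (rule summable_on_cmult_left[OF B])
    ultimately have "(\<Sum>\<^sub>\<infinity>m\<in>I. \<integral>x. h x * b m x \<partial>M) = (\<Sum>m. if m \<in> I then \<integral>x. h x * b m x \<partial>M else 0)"
      by (rule complex_infsum_eq_suminf(1))
    also have "\<dots> = (\<Sum>m. \<integral>x. h x * b' m x \<partial>M)"
      by (intro suminf_cong) (simp add: b'_def)
    finally show ?thesis
      by simp
  qed
  ultimately show "(\<integral>x. h x * (\<Sum>\<^sub>\<infinity>m\<in>I. b m x) \<partial>M) = (\<Sum>\<^sub>\<infinity>m\<in>I. \<integral>x. h x * b m x \<partial>M)"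
    by (simp add: infsum_b)
qed

section \<open>Interchange of the fermionic operators with integrals of vectors\<close>

lemma psi_integral: "psi i (\<lambda>T. \<integral>x. w x T \<partial>M) S = (\<integral>x. psi i (w x) S \<partial>M)"
  by (simp add: psi_def)

lemma integrable_psi:
  assumes "\<And>T. integrable M (\<lambda>x. w x T)"
  shows "integrable M (\<lambda>x. psi i (w x) S)"
  using assms by (cases "i \<in> occ S") (simp_all add: psi_def)

lemma integrable_psid:
  assumes "\<And>T. integrable M (\<lambda>x. w x T)"
  shows "integrable M (\<lambda>x. psid i (w x) S)"
  using assms by (cases "i \<in> occ S") (simp_all add: psid_def)

lemma pair_sum_integral:
  assumes w: "\<And>x. vanishes_off filled (w x)" and int: "\<And>T. integrable M (\<lambda>x. w x T)"
  shows "pair_sum (\<lambda>T. \<integral>x. w x T \<partial>M) S = (\<integral>x. pair_sum (w x) S \<partial>M)"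
proof -
  have "vanishes_off filled (\<lambda>T. \<integral>x. w x T \<partial>M)"
    using w by (simp add: vanishes_off_def)
  then have "pair_sum (\<lambda>T. \<integral>x. w x T \<partial>M) S
      = (\<Sum>i\<in>particles S. psi i (psi (i - 1) (\<lambda>T. \<integral>x. w x T \<partial>M)) S)"
    by (rule pair_sum_eq_sum) auto
  also have "\<dots> = (\<Sum>i\<in>particles S. \<integral>x. psi i (psi (i - 1) (w x)) S \<partial>M)"
  proof (intro sum.cong refl)
    fix i
    have "psi (i - 1) (\<lambda>T. \<integral>x. w x T \<partial>M) = (\<lambda>T. \<integral>x. psi (i - 1) (w x) T \<partial>M)"
      by (rule ext) (rule psi_integral)
    then show "psi i (psi (i - 1) (\<lambda>T. \<integral>x. w x T \<partial>M)) S = (\<integral>x. psi i (psi (i - 1) (w x)) S \<partial>M)"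
      by (simp only: psi_integral)
  qed
  also have "\<dots> = (\<integral>x. (\<Sum>i\<in>particles S. psi i (psi (i - 1) (w x)) S) \<partial>M)"
    by (rule Bochner_Integration.integral_sum[symmetric]) (intro integrable_psi int)
  also have "\<dots> = (\<integral>x. pair_sum (w x) S \<partial>M)"
    using w by (intro Bochner_Integration.integral_cong refl pair_sum_eq_sum[symmetric]) auto
  finally show ?thesis .
qed

lemma pair_sum_scale: "pair_sum (\<lambda>T. c * w T) S = c * pair_sum w S"
proof -
  have "psi i (psi (i - 1) (\<lambda>T. c * w T)) S = c * psi i (psi (i - 1) w) S" for i
    by (simp add: psi_def)
  then show ?thesis
    by (simp add: pair_sum_def infsum_cmult_right')
qed

lemma alpha_scale: "alpha m (\<lambda>T. c * w T) S = c * alpha m w S"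
proof -
  have "psi i (psid (i + int m) (\<lambda>T. c * w T)) S = c * psi i (psid (i + int m) w) S" for i
    by (simp add: psi_def psid_def)
  then show ?thesis
    by (simp add: alpha_def infsum_cmult_right')
qed

text \<open>The integral representation of \<open>v\<close> is required on one sector only, since
  \<open>v\<close> may have components of other charges; conservation of charge guarantees that none
  of those is read.\<close>

lemma alpha_integral:
  assumes m: "m \<ge> 1"
    and v: "vanishes_off filled v" and w: "\<And>x. vanishes_off filled (w x)"
    and eq: "\<And>T. T \<in> sector N \<Longrightarrow> v T = (\<integral>x. w x T \<partial>M)"
    and int: "\<And>T. integrable M (\<lambda>x. w x T)" and S: "S \<in> sector N"
  shows "alpha m v S = (\<integral>x. alpha m (w x) S \<partial>M)"
proof -
  have "alpha m v S = (\<Sum>i\<in>particles S. psi i (psid (i + int m) v) S)"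
    by (rule alpha_eq_sum[OF m v]) auto
  also have "\<dots> = (\<Sum>i\<in>particles S. \<integral>x. psi i (psid (i + int m) (w x)) S \<partial>M)"
  proof (intro sum.cong refl)
    fix i assume i: "i \<in> particles S"
    show "psi i (psid (i + int m) v) S = (\<integral>x. psi i (psid (i + int m) (w x)) S \<partial>M)"
    proof (cases "i + int m \<in> occ S")
      case True
      then show ?thesis
        using m by (simp add: psi_def psid_def)
    next
      case False
      then show ?thesis
        using eq[OF shift_sector[OF i False S]] by (simp add: psi_def psid_def)
    qed
  qed
  also have "\<dots> = (\<integral>x. (\<Sum>i\<in>particles S. psi i (psid (i + int m) (w x)) S) \<partial>M)"
    by (rule Bochner_Integration.integral_sum[symmetric]) (intro integrable_psi integrable_psid int)
  also have "\<dots> = (\<integral>x. alpha m (w x) S \<partial>M)"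
    using w by (intro Bochner_Integration.integral_cong refl alpha_eq_sum[OF m, symmetric]) auto
  finally show ?thesis .
qed

text \<open>Conjugation by \<Gamma> multiplies the field at \<open>z\<close> by the exponential of
  this number.\<close>

definition potential :: "(nat \<Rightarrow> complex) \<Rightarrow> complex \<Rightarrow> complex" where
  "potential p z = (\<Sum>\<^sub>\<infinity>m\<in>{1..}. p m / of_nat m * z ^ m)"

lemma coupling_term_summable:
  assumes "(\<lambda>m. norm (p m) / real m) summable_on {1..}" "norm z = 1"
  shows "(\<lambda>m. p m / of_nat m * z ^ m :: complex) summable_on {1..}"
  using assms(1)
  by (rule abs_summable_summable[OF Infinite_Sum.abs_summable_on_comparison_test'])
    (simp add: norm_mult norm_power norm_divide assms(2))

lemma sum_list_potential:
  assumes p: "(\<lambda>m. norm (p m) / real m) summable_on {1..}"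
    and "\<And>z. z \<in> set zs \<Longrightarrow> norm z = 1"
  shows "((\<lambda>m. p m / of_nat m * (\<Sum>z\<leftarrow>zs. z ^ m)) has_sum (\<Sum>z\<leftarrow>zs. potential p z)) {1..}"
  using assms(2)
proof (induction zs)
  case (Cons z zs)
  have "((\<lambda>m. p m / of_nat m * z ^ m) has_sum potential p z) {1..}"
    using Cons.prems coupling_term_summable[OF p] by (auto simp: potential_def)
  then have "((\<lambda>m. p m / of_nat m * z ^ m + p m / of_nat m * (\<Sum>z\<leftarrow>zs. z ^ m))
      has_sum (potential p z + (\<Sum>z\<leftarrow>zs. potential p z))) {1..}"
    by (rule has_sum_add) (use Cons in simp)
  then show ?case
    by (simp add: distrib_left)
qed simp

lemma norm_sum_list_le:
  fixes zs :: "complex list"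
  assumes "\<And>z. z \<in> set zs \<Longrightarrow> norm (f z) \<le> C"
  shows "norm (\<Sum>z\<leftarrow>zs. f z :: complex) \<le> real (length zs) * C"
  using assms
proof (induction zs)
  case (Cons z zs)
  have "norm (f z + (\<Sum>z\<leftarrow>zs. f z)) \<le> C + real (length zs) * C"
    using Cons by (intro norm_triangle_mono) auto
  then show ?case
    by (simp add: distrib_right)
qed simp

text \<open>
  The products of fields are eigenvectors of every \<open>\<alpha>\<^sub>m\<close>, so \<open>\<Gamma>\<close> multiplies each of them
  by a scalar under the integral sign.
\<close>

lemma Gamma_op_integral:
  fixes zs :: "'a \<Rightarrow> complex list"
  assumes p: "(\<lambda>m. norm (p m) / real m) summable_on {1..}"
    and h: "integrable M h" and len: "\<And>x. length (zs x) = N"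
    and unit: "\<And>x z. z \<in> set (zs x) \<Longrightarrow> norm z = 1"
    and zs: "\<And>i. i < N \<Longrightarrow> (\<lambda>x. zs x ! i) \<in> borel_measurable M"
    and W: "\<And>S. (\<lambda>x. field_prod (zs x) S) \<in> borel_measurable M"
    and u: "vanishes_off filled u"
    and eq: "\<And>S. S \<in> sector N \<Longrightarrow> u S = (\<integral>x. h x * field_prod (zs x) S \<partial>M)"
    and S: "S \<in> sector N"
  shows "Gamma_op p u S = (\<integral>x. h x * field_prod (zs x) S * exp (\<Sum>z\<leftarrow>zs x. potential p z) \<partial>M)"
    and "integrable M (\<lambda>x. h x * field_prod (zs x) S * exp (\<Sum>z\<leftarrow>zs x. potential p z))"
proof -
  define q where "q = (\<lambda>m. p m / of_nat m)"
  define s where "s = (\<lambda>m x. \<Sum>z\<leftarrow>zs x. z ^ m)"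
  define l where "l = (\<lambda>x. \<Sum>z\<leftarrow>zs x. potential p z)"
  \<comment> \<open>\<open>A\<close> is the exponent of \<Gamma>, and \<open>l x\<close> is its
    eigenvalue on the field product at \<open>x\<close>, built from the power sums
    \<open>s m x\<close>.\<close>
  define A where "A = (\<lambda>v S. \<Sum>\<^sub>\<infinity>m\<in>{1..}. q m * alpha m v S)"
  have A_app: "A v T = (\<Sum>\<^sub>\<infinity>m\<in>{1..}. q m * alpha m v T)" for v T
    by (simp add: A_def)
  define B where "B = (\<lambda>m. norm (p m) / real m * real N)"
  have B: "B summable_on {1..}"
    unfolding B_def by (rule summable_on_cmult_left[OF p])
  have s_meas: "s m \<in> borel_measurable M" for m
  proof -
    have "s m = (\<lambda>x. \<Sum>i<N. (zs x ! i) ^ m)"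
      using len by (auto simp: s_def sum_list_sum_nth atLeast0LessThan)
    then show ?thesis
      using zs by simp
  qed
  \<comment> \<open>The points have modulus 1, so each power sum is at most their number
    \<open>N\<close>, uniformly in \<open>m\<close> and \<open>x\<close>.\<close>
  have qs_bound: "norm (q m * s m x) \<le> B m" for m x
  proof -
    have "norm (s m x) \<le> real N * 1"
      unfolding s_def len[of x, symmetric] using unit by (intro norm_sum_list_le) (simp add: norm_power)
    then show ?thesis
      by (simp add: norm_mult q_def B_def norm_divide mult_left_mono flip: times_divide_eq_left)
  qed
  have l_eq: "l x = (\<Sum>\<^sub>\<infinity>m\<in>{1..}. q m * s m x)" for x
    using sum_list_potential[OF p unit, where zs = "zs x"]
    unfolding l_def q_def s_def by (intro infsumI[symmetric]) auto
  define C where "C = (\<Sum>\<^sub>\<infinity>m\<in>{1..}. B m)"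
  have l_meas [measurable]: "l \<in> borel_measurable M"
    using borel_measurable_infsum[where b = "\<lambda>m x. q m * s m x", OF h _ qs_bound B] s_meas
    by (simp add: l_eq[abs_def])
  have l_bound: "norm (l x) \<le> C" for x
  proof -
    have "(\<lambda>m. q m * s m x) summable_on {1..}"
      by (rule abs_summable_summable) (rule Infinite_Sum.abs_summable_on_comparison_test'[OF B qs_bound])
    then show ?thesis
      unfolding l_eq C_def by (rule norm_infsum_le[OF has_sum_infsum has_sum_infsum[OF B] qs_bound])
  qed
  have C: "0 \<le> C"
    using order.trans[OF norm_ge_zero l_bound] .
  have W_bound: "norm (field_prod (zs x) T) \<le> fact N" for x T
    using norm_field_prod_le[of "zs x" T] unit len by simp
  have int: "integrable M (\<lambda>x. h x * l x ^ k * field_prod (zs x) T)" for k T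
  proof (rule Bochner_Integration.integrable_bound)
    show "integrable M (\<lambda>x. (C ^ k * fact N) *\<^sub>R h x)"
      using h by simp
    have "norm (l x ^ k * field_prod (zs x) T) \<le> C ^ k * fact N" for x
      using l_bound[of x] W_bound[of x T] C
      by (auto simp: norm_mult norm_power intro!: mult_mono power_mono)
    then have "norm (h x) * norm (l x ^ k * field_prod (zs x) T) \<le> norm (h x) * (C ^ k * fact N)" for x
      by (intro mult_left_mono) auto
    then show "AE x in M. norm (h x * l x ^ k * field_prod (zs x) T) \<le> norm ((C ^ k * fact N) *\<^sub>R h x)"
      using C by (intro AE_I2) (simp add: norm_mult abs_mult mult_ac)
  qed (use h W in measurable)
  have filled: "vanishes_off filled ((A ^^ k) u)" for k
  proof (induction k)
    case (Suc k)
    then show ?case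
      using vanishes_off_alpha[OF _ Suc] by (auto simp: vanishes_off_def A_def intro!: infsum_0)
  qed (simp add: u)
  \<comment> \<open>Tracked only at states of sector \<open>N\<close>: nothing is assumed about
    \<open>u\<close> at other charges, and the induction never reads them.\<close>
  have pow: "(A ^^ k) u S = (\<integral>x. h x * l x ^ k * field_prod (zs x) S \<partial>M)" if "S \<in> sector N" for k S
    using that
  proof (induction k arbitrary: S)
    case (Suc k)
    have "alpha m ((A ^^ k) u) S = (\<integral>x. h x * l x ^ k * field_prod (zs x) S * s m x \<partial>M)"
      if m: "m \<in> {1..}" for m
    proof -
      have "vanishes_off filled (\<lambda>T. h x * l x ^ k * field_prod (zs x) T)" for x
        using field_prod_filled[of "zs x"] by (simp add: vanishes_off_def)
      then have "alpha m ((A ^^ k) u) S = (\<integral>x. alpha m (\<lambda>T. h x * l x ^ k * field_prod (zs x) T) S \<partial>M)"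
        using m Suc int by (intro alpha_integral[where N = N] filled) auto
      then show ?thesis
        using m by (simp only: alpha_scale alpha_field_prod s_def atLeast_iff) (simp add: mult_ac)
    qed
    then have "(A ^^ Suc k) u S
        = (\<Sum>\<^sub>\<infinity>m\<in>{1..}. \<integral>x. h x * l x ^ k * field_prod (zs x) S * (q m * s m x) \<partial>M)"
      by (auto simp: A_app mult.left_commute[of _ "q _"] intro!: infsum_cong)
    also have "\<dots> = (\<integral>x. h x * l x ^ k * field_prod (zs x) S * (\<Sum>\<^sub>\<infinity>m\<in>{1..}. q m * s m x) \<partial>M)"
      using s_meas by (intro integral_mult_infsum[symmetric, OF int _ qs_bound B]) auto
    also have "\<dots> = (\<integral>x. h x * l x ^ Suc k * field_prod (zs x) S \<partial>M)"
      unfolding l_eq[symmetric] by (simp add: mult_ac)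
    finally show ?case .
  qed (simp add: eq)
  have exp_infsum: "(\<Sum>\<^sub>\<infinity>k. l x ^ k / fact k) = exp (l x)" for x
  proof (rule infsumI, rule norm_summable_imp_has_sum)
    show "summable (\<lambda>k. norm (l x ^ k / fact k))"
      using summable_norm_exp[of "l x"] by (simp add: scaleR_conv_of_real norm_divide norm_mult divide_inverse mult.commute)
    show "(\<lambda>k. l x ^ k / fact k) sums exp (l x)"
      using exp_converges[of "l x"] by (simp add: scaleR_conv_of_real divide_inverse mult.commute)
  qed
  have "Gamma_op p u S = (\<Sum>\<^sub>\<infinity>k. (A ^^ k) u S / fact k)"
    by (simp add: Gamma_op_def op_exp_def A_def q_def)
  also have "\<dots> = (\<Sum>\<^sub>\<infinity>k. \<integral>x. h x * field_prod (zs x) S * (l x ^ k / fact k) \<partial>M)"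
    by (simp add: pow[OF S] mult_ac flip: integral_divide_zero)
  \<comment> \<open>The second exchange: since the eigenvalue is bounded by \<open>C\<close>, the
    exponential series of \<open>C\<close> dominates.\<close>
  also have "\<dots> = (\<integral>x. h x * field_prod (zs x) S * (\<Sum>\<^sub>\<infinity>k. l x ^ k / fact k) \<partial>M)"
  proof (rule integral_mult_infsum[symmetric])
    show "integrable M (\<lambda>x. h x * field_prod (zs x) S)"
      using int[of 0] by simp
    show "norm (l x ^ k / fact k) \<le> C ^ k / fact k" for x k
      using l_bound[of x] by (simp add: norm_divide norm_power divide_right_mono power_mono)
    show "(\<lambda>k. C ^ k / fact k) summable_on UNIV"
      using summable_norm_exp[of C] C by (intro norm_summable_imp_summable_on)
        (simp add: divide_inverse mult.commute)
  qed measurable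
  finally show "Gamma_op p u S = (\<integral>x. h x * field_prod (zs x) S * exp (\<Sum>z\<leftarrow>zs x. potential p z) \<partial>M)"
    unfolding exp_infsum by (simp only: l_def)
  have "integrable M (\<lambda>x. h x * field_prod (zs x) S * exp (l x))"
  proof (rule Bochner_Integration.integrable_bound)
    show "integrable M (\<lambda>x. exp C *\<^sub>R (h x * field_prod (zs x) S))"
      using int[of 0] by simp
    have "norm (exp (l x)) \<le> exp C" for x
      using order.trans[OF norm_exp exp_le_cancel_iff[THEN iffD2, OF l_bound]] .
    then have "norm (h x * field_prod (zs x) S) * norm (exp (l x)) \<le> norm (h x * field_prod (zs x) S) * exp C" for x
      by (intro mult_left_mono) auto
    then show "AE x in M. norm (h x * field_prod (zs x) S * exp (l x))
        \<le> norm (exp C *\<^sub>R (h x * field_prod (zs x) S))"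
      by (intro AE_I2) (simp add: norm_mult mult_ac)
  qed (use h W in measurable)
  then show "integrable M (\<lambda>x. h x * field_prod (zs x) S * exp (\<Sum>z\<leftarrow>zs x. potential p z))"
    by (simp only: l_def)
qed

section \<open>The pair operator as an integral over angles\<close>

text \<open>The weight is \<open>(1 / (4 \<pi> \<i>)) (x - x\<^sup>-\<^sup>1) dx / x\<close> at \<open>x = cis t\<close>, doubled
   because only half of the circle is used.\<close>

definition pair_weight :: "real \<Rightarrow> complex" where
  "pair_weight t = indicator {0..pi} t *\<^sub>R (\<i> / of_real pi * of_real (sin t))"

text \<open>Each application of the pair operator puts a new pair of fields on the left, so the
  largest index stands first, with the inverse point before the point.\<close>

primrec angle_points :: "nat \<Rightarrow> (nat \<Rightarrow> real) \<Rightarrow> complex list" where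
  "angle_points 0 \<theta> = []"
| "angle_points (Suc n) \<theta> = cis (- \<theta> (Suc n)) # cis (\<theta> (Suc n)) # angle_points n \<theta>"

lemma length_angle_points [simp]: "length (angle_points n \<theta>) = 2 * n"
  by (induction n) auto

lemma norm_angle_points: "z \<in> set (angle_points n \<theta>) \<Longrightarrow> norm z = 1"
  by (induction n) auto

lemma angle_points_update [simp]: "n < m \<Longrightarrow> angle_points n (\<theta>(m := t)) = angle_points n \<theta>"
  by (induction n) auto

text \<open>The weight vanishes off the interval, so continuity there suffices; the value is passed
  to the gauge integral, where the sine integrals were computed.\<close>

lemma has_bochner_integral_pair_weight:
  assumes "continuous_on {0..pi} f"
  shows "integrable lborel (\<lambda>t. pair_weight t * f t)"
    and "(\<integral>t. pair_weight t * f t \<partial>lborel) = integral {0..pi} (\<lambda>t. \<i> / of_real pi * of_real (sin t) * f t)"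
proof -
  let ?F = "\<lambda>t. \<i> / of_real pi * of_real (sin t) * f t"
  have eq: "pair_weight t * f t = indicator {0..pi} t *\<^sub>R ?F t" for t
    by (simp add: pair_weight_def)
  have "continuous_on {0..pi} ?F"
    using assms by (intro continuous_intros) auto
  then have int: "set_integrable lborel {0..pi} ?F"
    by (rule borel_integrable_atLeastAtMost')
  show "integrable lborel (\<lambda>t. pair_weight t * f t)"
    using int by (simp add: set_integrable_def eq)
  show "(\<integral>t. pair_weight t * f t \<partial>lborel) = integral {0..pi} ?F"
    using set_borel_integral_eq_integral(2)[OF int] unfolding set_lebesgue_integral_def eq .
qed

text \<open>The constants \<open>\<i> / pi\<close>, \<open>\<i>\<close> and \<open>pi / 2\<close>
  multiply to -1/2, which swaps the signs of the two indicators.\<close>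

lemma pair_weight_integral_sin:
  "(\<integral>t. pair_weight t * (\<i> * of_real (sin (of_int k * t))) \<partial>lborel)
    = 1 / 2 * ((if k = -1 then 1 else 0) - (if k = 1 then 1 else 0))"
proof -
  have "(\<integral>t. pair_weight t * (\<i> * of_real (sin (of_int k * t))) \<partial>lborel)
      = integral {0..pi} (\<lambda>t. \<i> / of_real pi * of_real (sin t) * (\<i> * of_real (sin (of_int k * t))))"
    by (intro has_bochner_integral_pair_weight continuous_intros)
  also have "\<dots> = integral {0..pi} (\<lambda>t. - 1 / of_real pi * of_real (sin t * sin (of_int k * t)))"
    by (intro Henstock_Kurzweil_Integration.integral_cong) (simp add: mult.assoc mult.left_commute)
  also have "\<dots> = - 1 / of_real pi * of_real (pi / 2 * ((if k = 1 then 1 else 0) - (if k = -1 then 1 else 0)))"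
    by (intro integral_unique has_integral_mult_right
      has_integral_linear[OF has_integral_sin_mult_sin bounded_linear_of_real, unfolded o_def])
  finally show ?thesis
    by simp
qed

text \<open>On half a circle \<open>sin t\<close> is not orthogonal to all cosines, so the cosine
  part must go before integrating: it is symmetric in \<open>i\<close> and \<open>j\<close>, whereas
  the coefficient is antisymmetric.\<close>

lemma pair_field_eq_sin_sum:
  assumes v: "vanishes_off filled v"
  shows "psi_field (cis (- t)) (psi_field (cis t) v) S
    = (\<Sum>i\<in>particles S. \<Sum>j\<in>particles S. psi i (psi j v) S * (\<i> * of_real (sin (of_int (j - i) * t))))"
proof -
  define P where "P = particles S"
  define a where "a = (\<lambda>i j. psi i (psi j v) S)"
  have "cis (- t) ^ nat i * cis t ^ nat j
      = of_real (cos (of_int (j - i) * t)) + \<i> * of_real (sin (of_int (j - i) * t))"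
    if "i \<in> P" "j \<in> P" for i j
  proof -
    have "cis (- t) ^ nat i * cis t ^ nat j = cis (of_int (j - i) * t)"
      using that particles_nonneg[of i S] particles_nonneg[of j S]
      by (simp add: P_def Complex.DeMoivre cis_mult algebra_simps)
    then show ?thesis
      by (simp add: complex_eq_iff)
  qed
  then have "psi_field (cis (- t)) (psi_field (cis t) v) S
      = (\<Sum>i\<in>P. \<Sum>j\<in>P. a i j * (of_real (cos (of_int (j - i) * t)) + \<i> * of_real (sin (of_int (j - i) * t))))"
    unfolding psi_field_psi_field[OF v] P_def[symmetric] a_def by (intro sum.cong refl) (simp add: mult.assoc)
  also have "\<dots> = (\<Sum>i\<in>P. \<Sum>j\<in>P. a i j * of_real (cos (of_int (j - i) * t)))
      + (\<Sum>i\<in>P. \<Sum>j\<in>P. a i j * (\<i> * of_real (sin (of_int (j - i) * t))))"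
    by (simp add: distrib_left sum.distrib)
  also have "(\<Sum>i\<in>P. \<Sum>j\<in>P. a i j * of_real (cos (of_int (j - i) * t))) = 0" (is "?C = 0")
  proof -
    have "?C = (\<Sum>i\<in>P. \<Sum>j\<in>P. a j i * of_real (cos (of_int (i - j) * t)))"
      by (rule sum.swap)
    also have "\<dots> = (\<Sum>i\<in>P. \<Sum>j\<in>P. - (a i j * of_real (cos (of_int (j - i) * t))))"
    proof (intro sum.cong refl)
      fix i j
      have "cos (of_int (i - j) * t) = cos (of_int (j - i) * t)"
        by (metis cos_minus minus_diff_eq mult_minus_left of_int_minus)
      moreover have "a j i = - a i j"
        using psi_psi[of i j v S] by (simp add: a_def eq_neg_iff_add_eq_0 add.commute)
      ultimately show "a j i * of_real (cos (of_int (i - j) * t)) = - (a i j * of_real (cos (of_int (j - i) * t)))"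
        by simp
    qed
    also have "\<dots> = - ?C"
      by (simp add: sum_negf)
    finally show ?thesis
      by simp
  qed
  finally show ?thesis
    by (simp add: P_def a_def)
qed

text \<open>Frequency -1 means \<open>i - j = 1\<close>, so the indicators match
  \<open>antisym_pair_sum\<close>, and 1/2 cancels its factor 2.\<close>

lemma pair_weight_integral:
  assumes v: "vanishes_off filled v"
  shows "(\<integral>t. pair_weight t * psi_field (cis (- t)) (psi_field (cis t) v) S \<partial>lborel) = pair_sum v S"
proof -
  let ?P = "particles S"
  let ?s = "\<lambda>i j t. pair_weight t * (\<i> * of_real (sin (of_int (j - i) * t)))"
  have int: "integrable lborel (?s i j)" for i j :: int
    by (intro has_bochner_integral_pair_weight continuous_intros)
  have "(\<integral>t. pair_weight t * psi_field (cis (- t)) (psi_field (cis t) v) S \<partial>lborel)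
      = (\<integral>t. (\<Sum>i\<in>?P. \<Sum>j\<in>?P. psi i (psi j v) S * ?s i j t) \<partial>lborel)"
    unfolding pair_field_eq_sin_sum[OF v] sum_distrib_left
    by (intro Bochner_Integration.integral_cong sum.cong refl) (simp only: mult_ac)
  also have "\<dots> = (\<Sum>i\<in>?P. \<Sum>j\<in>?P. psi i (psi j v) S * (\<integral>t. ?s i j t \<partial>lborel))"
    using int by (simp add: Bochner_Integration.integral_sum)
  also have "\<dots> = (\<Sum>i\<in>?P. \<Sum>j\<in>?P. 1 / 2 * (psi i (psi j v) S *
      ((if i - j = 1 then 1 else 0) - (if i - j = -1 then 1 else 0))))"
    unfolding pair_weight_integral_sin by (intro sum.cong refl) auto
  also have "\<dots> = pair_sum v S"
    unfolding sum_distrib_left[symmetric] antisym_pair_sum[OF v] by simp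
  finally show ?thesis .
qed

section \<open>Measurability and iterated integration on the space of angles\<close>

interpretation lborel_product: product_sigma_finite "\<lambda>_ :: nat. lborel :: real measure"
  by standard

abbreviation angle_space :: "nat \<Rightarrow> (nat \<Rightarrow> real) measure" where
  "angle_space n \<equiv> PiM {1..n} (\<lambda>_. lborel)"

lemma angle_measurable:
  assumes "i \<in> {1..n}"
  shows "(\<lambda>\<theta>. \<theta> i) \<in> borel_measurable (angle_space n)"
  using measurable_component_singleton[OF assms, of "\<lambda>_. lborel"] by simp

lemma cis_borel_measurable: "f \<in> borel_measurable M \<Longrightarrow> (\<lambda>x. cis (f x)) \<in> borel_measurable M"
  by (rule borel_measurable_continuous_on[where f = cis]) (intro continuous_on_cis continuous_on_id)

lemma angle_points_measurable:
  assumes "n \<le> N" "i < 2 * n"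
  shows "(\<lambda>\<theta>. angle_points n \<theta> ! i) \<in> borel_measurable (angle_space N)"
  using assms
proof (induction n arbitrary: i)
  case (Suc n)
  have "(\<lambda>\<theta>. \<theta> (Suc n)) \<in> borel_measurable (angle_space N)"
    using Suc by (intro angle_measurable) auto
  then have 1: "(\<lambda>\<theta>. cis (- \<theta> (Suc n))) \<in> borel_measurable (angle_space N)"
      "(\<lambda>\<theta>. cis (\<theta> (Suc n))) \<in> borel_measurable (angle_space N)"
    by (auto intro!: cis_borel_measurable)
  have 2: "(\<lambda>\<theta>. angle_points n \<theta> ! k) \<in> borel_measurable (angle_space N)" if "i = Suc (Suc k)" for k
    using Suc.prems that by (intro Suc.IH) auto
  consider "i = 0" | "i = Suc 0" | k where "i = Suc (Suc k)"
    using not0_implies_Suc by blast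
  then show ?case
    by cases (use 1 2 in simp_all)
qed simp

lemma field_prod_measurable:
  assumes "\<And>x. length (zs x) = N"
    and "\<And>i. i < N \<Longrightarrow> (\<lambda>x. zs x ! i) \<in> borel_measurable M"
  shows "(\<lambda>x. field_prod (zs x) S) \<in> borel_measurable M"
  using assms
proof (induction N arbitrary: zs S)
  case 0
  then show ?case
    by simp
next
  case (Suc N)
  define z where "z = (\<lambda>x. hd (zs x))"
  define ws where "ws = (\<lambda>x. tl (zs x))"
  have zs: "zs x = z x # ws x" for x
    using Suc.prems(1)[of x] by (cases "zs x") (auto simp: z_def ws_def)
  have "(\<lambda>x. z x) \<in> borel_measurable M"
    using Suc.prems(2)[of 0] by (simp add: zs)
  moreover have "(\<lambda>x. field_prod (ws x) T) \<in> borel_measurable M" for T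
  proof (rule Suc.IH)
    show "length (ws x) = N" for x
      using Suc.prems(1)[of x] by (simp add: zs)
    show "(\<lambda>x. ws x ! i) \<in> borel_measurable M" if "i < N" for i
      using Suc.prems(2)[of "Suc i"] that by (simp add: zs)
  qed
  then have "(\<lambda>x. psi i (field_prod (ws x)) S) \<in> borel_measurable M" for i
    by (cases "i \<in> occ S") (simp_all add: psi_def)
  ultimately show ?case
    unfolding zs field_prod_Cons_eq_sum by measurable
qed

lemma field_prod_angle_measurable:
  "(\<lambda>\<theta>. field_prod (angle_points n \<theta>) S) \<in> borel_measurable (angle_space n)"
  by (rule field_prod_measurable[OF length_angle_points]) (rule angle_points_measurable[OF order.refl])

lemma pair_weight_integrable: "integrable lborel pair_weight"
  using has_bochner_integral_pair_weight(1)[of "\<lambda>_. 1"] by simp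

lemma pair_weight_prod_integrable: "integrable (angle_space n) (\<lambda>\<theta>. \<Prod>i\<in>{1..n}. pair_weight (\<theta> i))"
  by (intro lborel_product.product_integrable_prod pair_weight_integrable) auto

lemma pair_weight_field_prod_integrable:
  "integrable (angle_space n) (\<lambda>\<theta>. (\<Prod>i\<in>{1..n}. pair_weight (\<theta> i)) * field_prod (angle_points n \<theta>) S)"
proof (rule Bochner_Integration.integrable_bound)
  show "integrable (angle_space n) (\<lambda>\<theta>. fact (2 * n) *\<^sub>R (\<Prod>i\<in>{1..n}. pair_weight (\<theta> i)))"
    by (intro integrable_scaleR_right impI pair_weight_prod_integrable)
  have "norm (field_prod (angle_points n \<theta>) S) \<le> fact (2 * n)" for \<theta>
    using norm_field_prod_le[of "angle_points n \<theta>"] norm_angle_points by simp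
  then have "norm (\<Prod>i\<in>{1..n}. pair_weight (\<theta> i)) * norm (field_prod (angle_points n \<theta>) S)
      \<le> norm (\<Prod>i\<in>{1..n}. pair_weight (\<theta> i)) * fact (2 * n)" for \<theta>
    by (intro mult_left_mono) auto
  then show "AE \<theta> in angle_space n.
      norm ((\<Prod>i\<in>{1..n}. pair_weight (\<theta> i)) * field_prod (angle_points n \<theta>) S)
      \<le> norm (fact (2 * n) *\<^sub>R (\<Prod>i\<in>{1..n}. pair_weight (\<theta> i)))"
    by (intro AE_I2) (simp add: norm_mult mult.commute[of "fact _"])
  show "(\<lambda>\<theta>. (\<Prod>i\<in>{1..n}. pair_weight (\<theta> i)) * field_prod (angle_points n \<theta>) S) \<in> borel_measurable (angle_space n)"
    by (intro borel_measurable_times field_prod_angle_measurable borel_measurable_integrable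
      pair_weight_prod_integrable)
qed

text \<open>Fubini with the newest angle innermost: its integral is one more application of
  \<open>pair_sum\<close>, which then moves outside the remaining integral. For \<open>n = 0\<close>
  the space of angles is a single point.\<close>

lemma pair_sum_pow_integral:
  "(pair_sum ^^ n) ket0 S
    = (\<integral>\<theta>. (\<Prod>i\<in>{1..n}. pair_weight (\<theta> i)) * field_prod (angle_points n \<theta>) S \<partial>angle_space n)"
proof (induction n arbitrary: S)
  case 0
  then show ?case
    by (simp add: PiM_empty)
next
  case (Suc n)
  let ?G = "\<lambda>n \<theta>. \<Prod>i\<in>{1..n}. pair_weight (\<theta> i)"
  have I: "{1..Suc n} = insert (Suc n) {1..n}"
    by auto
  have G: "?G (Suc n) (\<theta>(Suc n := t)) = ?G n \<theta> * pair_weight t" for \<theta> t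
  proof -
    have "(\<Prod>i\<in>{1..n}. pair_weight ((\<theta>(Suc n := t)) i)) = ?G n \<theta>"
      by (intro prod.cong) auto
    then show ?thesis
      by (simp add: mult.commute)
  qed
  have "(\<integral>\<theta>. ?G (Suc n) \<theta> * field_prod (angle_points (Suc n) \<theta>) S \<partial>angle_space (Suc n))
      = (\<integral>\<theta>. (\<integral>t. ?G (Suc n) (\<theta>(Suc n := t)) * field_prod (angle_points (Suc n) (\<theta>(Suc n := t))) S \<partial>lborel) \<partial>angle_space n)"
    using pair_weight_field_prod_integrable[of "Suc n" S] unfolding I
    by (intro lborel_product.product_integral_insert) auto
  also have "\<dots> = (\<integral>\<theta>. ?G n \<theta> * pair_sum (field_prod (angle_points n \<theta>)) S \<partial>angle_space n)"
    unfolding G angle_points.simps field_prod_simps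
    by (simp add: pair_weight_integral[OF field_prod_filled] mult.assoc del: prod.cl_ivl_Suc)
  also have "\<dots> = pair_sum (\<lambda>T. \<integral>\<theta>. ?G n \<theta> * field_prod (angle_points n \<theta>) T \<partial>angle_space n) S"
  proof (subst pair_sum_integral)
    show "vanishes_off filled (\<lambda>T. ?G n \<theta> * field_prod (angle_points n \<theta>) T)" for \<theta>
      using field_prod_filled[of "angle_points n \<theta>"] by (simp add: vanishes_off_def)
    show "integrable (angle_space n) (\<lambda>\<theta>. ?G n \<theta> * field_prod (angle_points n \<theta>) T)" for T
      by (rule pair_weight_field_prod_integrable)
  qed (simp add: pair_sum_scale)
  also have "(\<lambda>T. \<integral>\<theta>. ?G n \<theta> * field_prod (angle_points n \<theta>) T \<partial>angle_space n) = (pair_sum ^^ n) ket0"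
    using Suc by auto
  finally show ?case
    by simp
qed

text \<open>Charge singles out one term of the exponential series; this is where
  \<open>1 / fact n\<close> enters.\<close>

lemma op_exp_pair_sum_ket0:
  assumes "S \<in> sector (2 * n)"
  shows "op_exp pair_sum ket0 S = (pair_sum ^^ n) ket0 S / fact n"
proof -
  have "(pair_sum ^^ k) ket0 S = 0" if "k \<noteq> n" for k
    using pair_sum_pow_sector[of k] assms that by (auto simp: vanishes_off_def sector_def)
  then have "op_exp pair_sum ket0 S = (\<Sum>\<^sub>\<infinity>k\<in>{n}. (pair_sum ^^ k) ket0 S / fact k)"
    unfolding op_exp_def by (intro infsum_cong_neutral) auto
  then show ?thesis
    by simp
qed

lemma vanishes_off_op_exp_pair_sum: "vanishes_off filled (op_exp pair_sum ket0)"
proof -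
  have "vanishes_off filled ((pair_sum ^^ k) ket0)" for k
    by (rule vanishes_off_sector_filled[OF pair_sum_pow_sector])
  then show ?thesis
    by (simp add: vanishes_off_def op_exp_def)
qed

lemma bra_Gamma_op_exp_pair_sum:
  fixes n :: nat and p :: "nat \<Rightarrow> complex"
  assumes p: "(\<lambda>m. norm (p m) / real m) summable_on {1..}"
  defines "F \<equiv> \<lambda>\<theta>. (\<Prod>i\<in>{1..n}. pair_weight (\<theta> i)) / fact n * field_prod (angle_points n \<theta>) (packed (2 * n))
    * exp (\<Sum>z\<leftarrow>angle_points n \<theta>. potential p z)"
  shows "bra (2 * n) (Gamma_op p (op_exp pair_sum ket0)) = (\<integral>\<theta>. F \<theta> \<partial>angle_space n)"
    and "integrable (angle_space n) F"
proof -
  have h: "integrable (angle_space n) (\<lambda>\<theta>. (\<Prod>i\<in>{1..n}. pair_weight (\<theta> i)) / fact n)"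
    by (intro integrable_divide_zero impI pair_weight_prod_integrable)
  have unit: "norm z = 1" if "z \<in> set (angle_points n \<theta>)" for \<theta> z
    using that by (rule norm_angle_points)
  have points: "(\<lambda>\<theta>. angle_points n \<theta> ! i) \<in> borel_measurable (angle_space n)" if "i < 2 * n" for i
    using that by (rule angle_points_measurable[OF order.refl])
  have eq: "op_exp pair_sum ket0 S
      = (\<integral>\<theta>. (\<Prod>i\<in>{1..n}. pair_weight (\<theta> i)) / fact n * field_prod (angle_points n \<theta>) S \<partial>angle_space n)"
    if "S \<in> sector (2 * n)" for S
    using op_exp_pair_sum_ket0[OF that] by (simp add: pair_sum_pow_integral)
  note Gamma = Gamma_op_integral[OF p h length_angle_points unit points field_prod_angle_measurable
    vanishes_off_op_exp_pair_sum eq packed_sector]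
  show "bra (2 * n) (Gamma_op p (op_exp pair_sum ket0)) = (\<integral>\<theta>. F \<theta> \<partial>angle_space n)"
    unfolding bra_eq_packed F_def by (rule Gamma(1))
  show "integrable (angle_space n) F"
    unfolding F_def by (rule Gamma(2))
qed

section \<open>Integrals of symmetric functions over the ordered chamber\<close>

lemma ex1_sorting_permutation:
  fixes \<theta> :: "nat \<Rightarrow> real"
  assumes inj: "inj_on \<theta> {1..n}"
  shows "\<exists>!\<sigma>. \<sigma> permutes {1..n} \<and> mono_on {1..n} (\<theta> \<circ> \<sigma>)"
proof (rule ex_ex1I)
  define xs where "xs = sorted_list_of_set (\<theta> ` {1..n})"
  have xs: "sorted xs" "distinct xs" "set xs = \<theta> ` {1..n}" "length xs = n"
    using inj by (auto simp: xs_def card_image)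
  \<comment> \<open>The index of the i-th smallest value; the shift by 1 is due to lists being
    indexed from 0 and angles from 1.\<close>
  define \<sigma> where "\<sigma> = (\<lambda>i. if i \<in> {1..n} then inv_into {1..n} \<theta> (xs ! (i - 1)) else i)"
  have xs_in: "xs ! (i - 1) \<in> \<theta> ` {1..n}" if "i \<in> {1..n}" for i
    using that xs(3,4) nth_mem[of "i - 1" xs] by auto
  then have \<theta>\<sigma>: "\<theta> (\<sigma> i) = xs ! (i - 1)" and \<sigma>_in: "\<sigma> i \<in> {1..n}" if "i \<in> {1..n}" for i
    using that f_inv_into_f[OF xs_in] inv_into_into[OF xs_in] by (auto simp: \<sigma>_def)
  have "inj_on \<sigma> {1..n}"
  proof (rule inj_onI)
    fix i j assume ij: "i \<in> {1..n}" "j \<in> {1..n}" "\<sigma> i = \<sigma> j"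
    then have "xs ! (i - 1) = xs ! (j - 1)"
      by (metis \<theta>\<sigma>)
    then have "i - 1 = j - 1"
      using ij xs(2,4) by (subst (asm) nth_eq_iff_index_eq) auto
    then show "i = j"
      using ij by auto
  qed
  then have "bij_betw \<sigma> {1..n} {1..n}"
    using \<sigma>_in by (intro bij_betw_imageI endo_inj_surj) auto
  then have "\<sigma> permutes {1..n}"
    by (rule bij_imp_permutes) (auto simp: \<sigma>_def)
  moreover have "mono_on {1..n} (\<theta> \<circ> \<sigma>)"
  proof (rule mono_onI)
    fix i j assume "i \<in> {1..n}" "j \<in> {1..n}" "i \<le> j"
    then show "(\<theta> \<circ> \<sigma>) i \<le> (\<theta> \<circ> \<sigma>) j"
      using \<theta>\<sigma> xs(4) by (auto intro!: sorted_nth_mono[OF xs(1)])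
  qed
  ultimately show "\<exists>\<sigma>. \<sigma> permutes {1..n} \<and> mono_on {1..n} (\<theta> \<circ> \<sigma>)"
    by blast
next
  fix \<sigma> \<tau>
  assume \<sigma>: "\<sigma> permutes {1..n} \<and> mono_on {1..n} (\<theta> \<circ> \<sigma>)"
    and \<tau>: "\<tau> permutes {1..n} \<and> mono_on {1..n} (\<theta> \<circ> \<tau>)"
  have *: "sorted (map (\<theta> \<circ> \<rho>) [1..<Suc n])" "distinct (map (\<theta> \<circ> \<rho>) [1..<Suc n])"
      "set (map (\<theta> \<circ> \<rho>) [1..<Suc n]) = \<theta> ` {1..n}"
    if \<rho>: "\<rho> permutes {1..n} \<and> mono_on {1..n} (\<theta> \<circ> \<rho>)" for \<rho>
  proof -
    have set: "set [1..<Suc n] = {1..n}"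
      by auto
    have image: "\<rho> ` {1..n} = {1..n}"
      using \<rho> permutes_image by blast
    show "sorted (map (\<theta> \<circ> \<rho>) [1..<Suc n])"
      unfolding sorted_map
    proof (rule sorted_wrt_mono_rel[OF _ sorted_upt])
      fix x y assume "x \<in> set [1..<Suc n]" "y \<in> set [1..<Suc n]" "x \<le> y"
      then show "(\<theta> \<circ> \<rho>) x \<le> (\<theta> \<circ> \<rho>) y"
        using \<rho> unfolding set by (blast intro: mono_onD)
    qed
    have "inj_on (\<theta> \<circ> \<rho>) {1..n}"
    proof (rule comp_inj_on)
      show "inj_on \<rho> {1..n}"
        using \<rho> permutes_inj_on by blast
      show "inj_on \<theta> (\<rho> ` {1..n})"
        unfolding image by (rule inj)
    qed
    then show "distinct (map (\<theta> \<circ> \<rho>) [1..<Suc n])"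
      unfolding distinct_map set by simp
    show "set (map (\<theta> \<circ> \<rho>) [1..<Suc n]) = \<theta> ` {1..n}"
      unfolding set_map set image_comp[symmetric] image ..
  qed
  \<comment> \<open>Uniqueness: both rearrangements are the strictly sorted list of the same set of
    values.\<close>
  have "map (\<theta> \<circ> \<sigma>) [1..<Suc n] = map (\<theta> \<circ> \<tau>) [1..<Suc n]"
    using *[OF \<sigma>] *[OF \<tau>] by (intro sorted_distinct_set_unique) auto
  then have "\<forall>i\<in>set [1..<Suc n]. (\<theta> \<circ> \<sigma>) i = (\<theta> \<circ> \<tau>) i"
    by (simp only: map_eq_conv)
  then have eq: "\<theta> (\<sigma> i) = \<theta> (\<tau> i)" if "i \<in> {1..n}" for i
    using that unfolding set_upt atLeastLessThanSuc_atLeastAtMost comp_def by blast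
  show "\<sigma> = \<tau>"
  proof
    fix i
    show "\<sigma> i = \<tau> i"
    proof (cases "i \<in> {1..n}")
      case True
      then have "\<sigma> i \<in> {1..n}" "\<tau> i \<in> {1..n}"
        using permutes_in_image[OF conjunct1[OF \<sigma>]] permutes_in_image[OF conjunct1[OF \<tau>]] by simp_all
      then show ?thesis
        using inj_onD[OF inj eq[OF True]] by blast
    next
      case False
      then have "\<sigma> i = i" "\<tau> i = i"
        using permutes_not_in[OF conjunct1[OF \<sigma>] False] permutes_not_in[OF conjunct1[OF \<tau>] False]
        by simp_all
      then show ?thesis
        by simp
    qed
  qed
qed

text \<open>Boxes determine the product measure, and relabelling coordinates only permutes the sides
  of a box, all measured by the same \<open>N\<close>.\<close>

lemma distr_PiM_permute:
  fixes N :: "'b measure"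
  assumes "sigma_finite_measure N" and \<sigma>: "\<sigma> permutes I" and I: "finite I"
  shows "(\<lambda>\<theta>. \<theta> \<circ> \<sigma>) \<in> PiM I (\<lambda>_. N) \<rightarrow>\<^sub>M PiM I (\<lambda>_. N)"
    and "distr (PiM I (\<lambda>_. N)) (PiM I (\<lambda>_. N)) (\<lambda>\<theta>. \<theta> \<circ> \<sigma>) = PiM I (\<lambda>_. N)"
proof -
  interpret N: sigma_finite_measure N by fact
  interpret product_sigma_finite "\<lambda>_. N" by standard
  have in_I: "\<sigma> i \<in> I \<longleftrightarrow> i \<in> I" for i
    using \<sigma> by (rule permutes_in_image)
  show meas: "(\<lambda>\<theta>. \<theta> \<circ> \<sigma>) \<in> PiM I (\<lambda>_. N) \<rightarrow>\<^sub>M PiM I (\<lambda>_. N)"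
  proof (rule measurable_PiM_single')
    show "(\<lambda>\<theta>. (\<theta> \<circ> \<sigma>) i) \<in> PiM I (\<lambda>_. N) \<rightarrow>\<^sub>M N" if "i \<in> I" for i
      using that in_I by (simp add: measurable_component_singleton)
    show "(\<lambda>\<theta>. \<theta> \<circ> \<sigma>) \<in> space (PiM I (\<lambda>_. N)) \<rightarrow> (\<Pi>\<^sub>E i\<in>I. space N)"
      using in_I by (auto simp: space_PiM PiE_def extensional_def)
  qed
  show "distr (PiM I (\<lambda>_. N)) (PiM I (\<lambda>_. N)) (\<lambda>\<theta>. \<theta> \<circ> \<sigma>) = PiM I (\<lambda>_. N)"
  proof (rule PiM_eqI)
    fix A :: "'a \<Rightarrow> 'b set"
    assume A: "\<And>i. i \<in> I \<Longrightarrow> A i \<in> sets N"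
    have "(\<lambda>\<theta>. \<theta> \<circ> \<sigma>) -` PiE I A \<inter> space (PiM I (\<lambda>_. N)) = PiE I (A \<circ> inv \<sigma>)"
    proof (intro set_eqI iffI)
      fix \<theta> assume \<theta>: "\<theta> \<in> (\<lambda>\<theta>. \<theta> \<circ> \<sigma>) -` PiE I A \<inter> space (PiM I (\<lambda>_. N))"
      have "\<theta> i \<in> A (inv \<sigma> i)" if "i \<in> I" for i
      proof -
        have "inv \<sigma> i \<in> I"
          using \<sigma> that by (metis permutes_in_image permutes_inv)
        then have "(\<theta> \<circ> \<sigma>) (inv \<sigma> i) \<in> A (inv \<sigma> i)"
          using \<theta> by (auto simp: PiE_def Pi_def)
        then show ?thesis
          using \<sigma> by (simp add: permutes_inverses)
      qed
      then show "\<theta> \<in> PiE I (A \<circ> inv \<sigma>)"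
        using \<theta> by (auto simp: space_PiM PiE_def)
    next
      fix \<theta> assume \<theta>: "\<theta> \<in> PiE I (A \<circ> inv \<sigma>)"
      have "\<theta> (\<sigma> i) \<in> A i" if "i \<in> I" for i
      proof -
        have "\<theta> (\<sigma> i) \<in> A (inv \<sigma> (\<sigma> i))"
          using \<theta> that in_I by (auto simp: PiE_def Pi_def)
        then show ?thesis
          using \<sigma> by (simp add: permutes_inverses)
      qed
      moreover have "\<theta> i \<in> space N" if "i \<in> I" for i
      proof -
        have "inv \<sigma> i \<in> I"
          using \<sigma> that by (metis permutes_in_image permutes_inv)
        then have "A (inv \<sigma> i) \<subseteq> space N"
          using sets.sets_into_space[OF A] by blast
        then show ?thesis
          using PiE_mem[OF \<theta> that] by auto
      qed
      ultimately show "\<theta> \<in> (\<lambda>\<theta>. \<theta> \<circ> \<sigma>) -` PiE I A \<inter> space (PiM I (\<lambda>_. N))"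
        using \<theta> in_I by (auto simp: space_PiM PiE_def extensional_def)
    qed
    then have "emeasure (distr (PiM I (\<lambda>_. N)) (PiM I (\<lambda>_. N)) (\<lambda>\<theta>. \<theta> \<circ> \<sigma>)) (PiE I A)
        = emeasure (PiM I (\<lambda>_. N)) (PiE I (A \<circ> inv \<sigma>))"
      using A I by (subst emeasure_distr[OF meas]) (auto intro!: sets_PiM_I_finite)
    also have "\<dots> = (\<Prod>i\<in>I. emeasure N ((A \<circ> inv \<sigma>) i))"
    proof (rule emeasure_PiM[OF I])
      show "(A \<circ> inv \<sigma>) i \<in> sets N" if "i \<in> I" for i
        using that A \<sigma> by (metis comp_apply permutes_in_image permutes_inv)
    qed
    also have "\<dots> = (\<Prod>i\<in>I. emeasure N (A i))"
      using prod.permute[OF permutes_inv[OF \<sigma>], of "\<lambda>i. emeasure N (A i)"] by (simp add: comp_def)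
    finally show "emeasure (distr (PiM I (\<lambda>_. N)) (PiM I (\<lambda>_. N)) (\<lambda>\<theta>. \<theta> \<circ> \<sigma>)) (PiE I A)
        = (\<Prod>i\<in>I. emeasure N (A i))" .
  qed (use I in simp_all)
qed

text \<open>Away from ties exactly one rearrangement of \<theta> is sorted, and at ties
  \<open>f\<close> is 0; so \<open>f\<close> is the sum of the rearranged chamber pieces at every
  point and not merely almost everywhere.\<close>

lemma integral_symmetric_eq_chamber:
  fixes f :: "(nat \<Rightarrow> real) \<Rightarrow> complex"
  assumes int: "integrable (PiM {1..n} (\<lambda>_. lborel)) f"
    and sym: "\<And>\<theta> \<sigma>. \<sigma> permutes {1..n} \<Longrightarrow> f (\<theta> \<circ> \<sigma>) = f \<theta>"
    and ties: "\<And>\<theta>. \<not> inj_on \<theta> {1..n} \<Longrightarrow> f \<theta> = 0"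
  shows "(\<integral>\<theta>. f \<theta> \<partial>PiM {1..n} (\<lambda>_. lborel))
    = fact n * (\<integral>\<theta>. indicator {\<theta>. mono_on {1..n} \<theta>} \<theta> *\<^sub>R f \<theta> \<partial>PiM {1..n} (\<lambda>_. lborel))"
proof -
  let ?M = "PiM {1..n} (\<lambda>_. lborel :: real measure)"
  define g where "g = (\<lambda>\<theta>. indicator {\<theta>. mono_on {1..n} \<theta>} \<theta> *\<^sub>R f \<theta>)"
  let ?P = "{\<sigma>. \<sigma> permutes {1..n}}"
  have lb: "sigma_finite_measure (lborel :: real measure)"
    by standard
  have f_meas [measurable]: "f \<in> borel_measurable ?M"
    using int by auto
  have "{\<theta> \<in> space ?M. mono_on {1..n} \<theta>}
      = {\<theta> \<in> space ?M. \<forall>i\<in>{1..n}. \<forall>j\<in>{1..n}. i \<le> j \<longrightarrow> \<theta> i \<le> \<theta> j}"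
    by (auto simp: mono_on_def)
  also have "\<dots> \<in> sets ?M"
  proof (intro sets.sets_Collect_finite_All sets.sets_Collect_imp sets.sets_Collect_const)
    fix i j assume ij: "i \<in> {1..n}" "j \<in> {1..n}"
    have c: "(\<lambda>\<theta>. \<theta> k) \<in> borel_measurable ?M" if "k \<in> {1..n}" for k
      using measurable_component_singleton[OF that, of "\<lambda>_. lborel"] by simp
    show "{\<theta> \<in> space ?M. \<theta> i \<le> \<theta> j} \<in> sets ?M"
      by (rule borel_measurable_le[OF c[OF ij(1)] c[OF ij(2)]])
  qed auto
  finally have "{\<theta> \<in> space ?M. mono_on {1..n} \<theta>} \<in> sets ?M" .
  then have "integrable ?M (\<lambda>\<theta>. indicator {\<theta> \<in> space ?M. mono_on {1..n} \<theta>} \<theta> *\<^sub>R f \<theta>)"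
    by (rule integrable_mult_indicator[OF _ int])
  then have g_int: "integrable ?M g"
    by (rule Bochner_Integration.integrable_cong[THEN iffD1, rotated -1])
      (auto simp: g_def indicator_def)
  have "(\<integral>\<theta>. f \<theta> \<partial>?M) = (\<integral>\<theta>. (\<Sum>\<sigma>\<in>?P. g (\<theta> \<circ> \<sigma>)) \<partial>?M)"
  proof (intro Bochner_Integration.integral_cong refl)
    fix \<theta> :: "nat \<Rightarrow> real"
    have sum_g: "(\<Sum>\<sigma>\<in>?P. g (\<theta> \<circ> \<sigma>)) = (\<Sum>\<sigma>\<in>?P. indicator {\<theta>. mono_on {1..n} \<theta>} (\<theta> \<circ> \<sigma>) *\<^sub>R f \<theta>)"
      by (intro sum.cong refl) (simp add: g_def sym)
    show "f \<theta> = (\<Sum>\<sigma>\<in>?P. g (\<theta> \<circ> \<sigma>))"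
    proof (cases "inj_on \<theta> {1..n}")
      case True
      obtain \<sigma> where \<sigma>: "\<sigma> permutes {1..n}" "mono_on {1..n} (\<theta> \<circ> \<sigma>)"
        and uniq: "\<And>\<tau>. \<tau> permutes {1..n} \<Longrightarrow> mono_on {1..n} (\<theta> \<circ> \<tau>) \<Longrightarrow> \<tau> = \<sigma>"
        using ex1_sorting_permutation[OF True] by metis
      have "(\<Sum>\<tau>\<in>?P. indicator {\<theta>. mono_on {1..n} \<theta>} (\<theta> \<circ> \<tau>) *\<^sub>R f \<theta>)
          = (\<Sum>\<tau>\<in>?P. if \<tau> = \<sigma> then f \<theta> else 0)"
      proof (intro sum.cong refl)
        fix \<tau> assume "\<tau> \<in> ?P"
        then have "mono_on {1..n} (\<theta> \<circ> \<tau>) \<longleftrightarrow> \<tau> = \<sigma>"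
          using \<sigma>(2) uniq[of \<tau>] by blast
        then show "indicator {\<theta>. mono_on {1..n} \<theta>} (\<theta> \<circ> \<tau>) *\<^sub>R f \<theta> = (if \<tau> = \<sigma> then f \<theta> else 0)"
          unfolding indicator_def mem_Collect_eq by (simp only: split: if_split) simp
      qed
      also have "\<dots> = f \<theta>"
        using \<sigma> by (simp add: finite_permutations)
      finally show ?thesis
        using sum_g by simp
    next
      case False
      then show ?thesis
        using sum_g by (simp add: ties)
    qed
  qed
  also have "\<dots> = (\<Sum>\<sigma>\<in>?P. \<integral>\<theta>. g (\<theta> \<circ> \<sigma>) \<partial>?M)"
  proof (rule Bochner_Integration.integral_sum)
    fix \<sigma> assume "\<sigma> \<in> ?P"
    then have \<sigma>: "\<sigma> permutes {1..n}"
      by simp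
    show "integrable ?M (\<lambda>\<theta>. g (\<theta> \<circ> \<sigma>))"
      by (rule integrable_distr[OF distr_PiM_permute(1)[OF lb \<sigma> finite_atLeastAtMost]])
        (simp only: distr_PiM_permute(2)[OF lb \<sigma> finite_atLeastAtMost] g_int)
  qed
  also have "\<dots> = (\<Sum>\<sigma>\<in>?P. \<integral>\<theta>. g \<theta> \<partial>?M)"
  proof (intro sum.cong refl)
    fix \<sigma> assume "\<sigma> \<in> ?P"
    then have \<sigma>: "\<sigma> permutes {1..n}"
      by simp
    show "(\<integral>\<theta>. g (\<theta> \<circ> \<sigma>) \<partial>?M) = (\<integral>\<theta>. g \<theta> \<partial>?M)"
      using integral_distr[OF distr_PiM_permute(1)[OF lb \<sigma> finite_atLeastAtMost]
        borel_measurable_integrable[OF g_int]]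
      by (simp only: distr_PiM_permute(2)[OF lb \<sigma> finite_atLeastAtMost])
  qed
  also have "\<dots> = fact n * (\<integral>\<theta>. g \<theta> \<partial>?M)"
    using card_permutations[of "{1..n}" n] by simp
  finally show ?thesis
    by (simp add: g_def)
qed

text \<open>Trades the condition \<open>i < j\<close>, which a permutation does not respect, for
  \<open>i \<noteq> j\<close>, which it does.\<close>

lemma prod_upper_triangle:
  fixes a :: "nat \<Rightarrow> nat \<Rightarrow> 'a :: comm_monoid_mult"
  shows "(\<Prod>j\<in>{1..n}. \<Prod>i\<in>{1..<j}. a i j * a j i) = (\<Prod>i\<in>{1..n}. \<Prod>j\<in>{1..n} - {i}. a i j)"
proof (induction n)
  case (Suc n)
  have 1: "{1..<Suc n} = {1..n}" "{1..Suc n} - {Suc n} = {1..n}"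
    by auto
  have 2: "(\<Prod>i\<in>{1..Suc n}. F i) = F (Suc n) * (\<Prod>i\<in>{1..n}. F i)" for F :: "nat \<Rightarrow> 'a"
    by (simp add: mult.commute)
  have "(\<Prod>i\<in>{1..n}. \<Prod>j\<in>{1..Suc n} - {i}. a i j) = (\<Prod>i\<in>{1..n}. a i (Suc n) * (\<Prod>j\<in>{1..n} - {i}. a i j))"
  proof (intro prod.cong refl)
    fix i assume "i \<in> {1..n}"
    then have "{1..Suc n} - {i} = insert (Suc n) ({1..n} - {i})"
      by auto
    then show "(\<Prod>j\<in>{1..Suc n} - {i}. a i j) = a i (Suc n) * (\<Prod>j\<in>{1..n} - {i}. a i j)"
      by (metis Diff_iff atLeastAtMost_iff finite_Diff finite_atLeastAtMost not_less_eq_eq order_refl prod.insert)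
  qed
  then have e1: "(\<Prod>i\<in>{1..Suc n}. \<Prod>j\<in>{1..Suc n} - {i}. a i j)
      = (\<Prod>j\<in>{1..n}. a (Suc n) j) * ((\<Prod>i\<in>{1..n}. a i (Suc n)) * (\<Prod>i\<in>{1..n}. \<Prod>j\<in>{1..n} - {i}. a i j))"
    by (simp only: 2 1(2) prod.distrib)
  have e2: "(\<Prod>j\<in>{1..Suc n}. \<Prod>i\<in>{1..<j}. a i j * a j i)
      = (\<Prod>i\<in>{1..n}. a i (Suc n) * a (Suc n) i) * (\<Prod>j\<in>{1..n}. \<Prod>i\<in>{1..<j}. a i j * a j i)"
    by (simp only: 2 1(1))
  have e3: "(\<Prod>i\<in>{1..n}. a i (Suc n) * a (Suc n) i)
      = (\<Prod>i\<in>{1..n}. a i (Suc n)) * (\<Prod>i\<in>{1..n}. a (Suc n) i)"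
    by (rule prod.distrib)
  show ?case
    by (simp only: e1 e2 e3 Suc.IH) (simp only: mult_ac)
qed simp

lemma prod_pairs_permute:
  fixes c :: "nat \<Rightarrow> real"
  assumes \<sigma>: "\<sigma> permutes {1..n}"
  shows "(\<Prod>j\<in>{1..n}. \<Prod>i\<in>{1..<j}. (c (\<sigma> i) - c (\<sigma> j))\<^sup>2) = (\<Prod>j\<in>{1..n}. \<Prod>i\<in>{1..<j}. (c i - c j)\<^sup>2)"
proof -
  \<comment> \<open>as a product over all ordered pairs the expression is visibly symmetric\<close>
  have *: "(\<Prod>j\<in>{1..n}. \<Prod>i\<in>{1..<j}. (d i - d j)\<^sup>2) = (\<Prod>i\<in>{1..n}. \<Prod>j\<in>{1..n} - {i}. \<bar>d i - d j\<bar>)"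
    for d :: "nat \<Rightarrow> real"
  proof -
    have "(d i - d j)\<^sup>2 = \<bar>d i - d j\<bar> * \<bar>d j - d i\<bar>" for i j
      by (simp add: power2_eq_square abs_minus_commute flip: abs_mult)
    then show ?thesis
      using prod_upper_triangle[of "\<lambda>i j. \<bar>d i - d j\<bar>" n] by simp
  qed
  have "(\<Prod>i\<in>{1..n}. \<Prod>j\<in>{1..n} - {i}. \<bar>c (\<sigma> i) - c (\<sigma> j)\<bar>)
      = (\<Prod>i\<in>{1..n}. \<Prod>j\<in>{1..n} - {\<sigma> i}. \<bar>c (\<sigma> i) - c j\<bar>)"
  proof (rule prod.cong[OF refl])
    fix i
    have "bij_betw \<sigma> ({1..n} - {i}) ({1..n} - {\<sigma> i})"
      by (rule bij_betw_imageI)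
        (simp_all only: permutes_inj_on[OF \<sigma>] image_set_diff[OF permutes_inj[OF \<sigma>]]
          permutes_image[OF \<sigma>] image_insert image_empty)
    then show "(\<Prod>j\<in>{1..n} - {i}. \<bar>c (\<sigma> i) - c (\<sigma> j)\<bar>) = (\<Prod>j\<in>{1..n} - {\<sigma> i}. \<bar>c (\<sigma> i) - c j\<bar>)"
      by (rule prod.reindex_bij_betw)
  qed
  also have "\<dots> = (\<Prod>i\<in>{1..n}. \<Prod>j\<in>{1..n} - {i}. \<bar>c i - c j\<bar>)"
    using prod.permute[OF \<sigma>, of "\<lambda>i. \<Prod>j\<in>{1..n} - {i}. \<bar>c i - c j\<bar>"] by (simp add: comp_def)
  finally show ?thesis
    using *[of "c \<circ> \<sigma>"] *[of c] by simp
qed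

section \<open>Evaluation of the integrand\<close>

lemma prod_list_angle_points:
  "(\<Prod>w\<leftarrow>angle_points n \<theta>. z - w) = (\<Prod>i\<in>{1..n}. (z - cis (- \<theta> i)) * (z - cis (\<theta> i)))"
  by (induction n) (simp_all add: mult_ac)

text \<open>For \<open>u * v = 1\<close> one has
  \<open>(x - u) * (x - v) = x * (x + 1 / x - u - v)\<close>, and likewise at \<open>1 / x\<close>;
  the prefactors cancel in the product.\<close>

lemma cis_cross_product:
  "(cis (- t) - cis (- s)) * (cis (- t) - cis s) * ((cis t - cis (- s)) * (cis t - cis s))
    = of_real ((2 * cos t - 2 * cos s)\<^sup>2)"
proof -
  have "(y - v) * (y - u) * ((x - v) * (x - u)) = ((x + y) - (u + v))\<^sup>2"
    if "x * y = 1" "u * v = 1" for x y u v :: complex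
    using that by algebra
  moreover have "cis a * cis (- a) = 1" "cis a + cis (- a) = of_real (2 * cos a)" for a
    by (simp_all add: cis_mult complex_eq_iff)
  ultimately show ?thesis
    by simp
qed

text \<open>Two steps of the Vandermonde recursion per angle: the new pair contributes its own
  difference, a sine, and one cross product with every earlier pair.\<close>

lemma field_prod_angle_points:
  "field_prod (angle_points n \<theta>) (packed (2 * n))
    = (\<Prod>j\<in>{1..n}. - 2 * \<i> * of_real (sin (\<theta> j)) * (\<Prod>i\<in>{1..<j}. of_real ((2 * cos (\<theta> j) - 2 * cos (\<theta> i))\<^sup>2)))"
proof (induction n)
  case 0
  then show ?case
    by (simp add: ket0_def)
next
  case (Suc n)
  define t where "t = \<theta> (Suc n)"
  define ws where "ws = angle_points n \<theta>"
  have len: "length ws = 2 * n"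
    by (simp add: ws_def)
  have "field_prod (cis (- t) # cis t # ws) (packed (2 * Suc n))
      = (\<Prod>w\<leftarrow>cis t # ws. cis (- t) - w) * field_prod (cis t # ws) (packed (Suc (length ws)))"
    using field_prod_Cons_packed[of "cis (- t)" "cis t # ws"] by (simp add: len del: field_prod_simps packed.simps)
  also have "\<dots> = (cis (- t) - cis t) * ((\<Prod>w\<leftarrow>ws. cis (- t) - w) * (\<Prod>w\<leftarrow>ws. cis t - w))
      * field_prod ws (packed (length ws))"
    unfolding field_prod_Cons_packed by simp
  also have "cis (- t) - cis t = - 2 * \<i> * of_real (sin t)"
    by (simp add: complex_eq_iff)
  also have "(\<Prod>w\<leftarrow>ws. cis (- t) - w) * (\<Prod>w\<leftarrow>ws. cis t - w)
      = (\<Prod>i\<in>{1..n}. of_real ((2 * cos t - 2 * cos (\<theta> i))\<^sup>2))"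
    unfolding ws_def prod_list_angle_points prod.distrib[symmetric] cis_cross_product ..
  finally have "field_prod (angle_points (Suc n) \<theta>) (packed (2 * Suc n))
      = - 2 * \<i> * of_real (sin t) * (\<Prod>i\<in>{1..n}. of_real ((2 * cos t - 2 * cos (\<theta> i))\<^sup>2))
        * field_prod (angle_points n \<theta>) (packed (2 * n))"
    by (simp only: angle_points.simps t_def ws_def length_angle_points)
  moreover have "{1..<Suc n} = {1..n}"
    by auto
  moreover have "(\<Prod>j\<in>{1..Suc n}. G j) = G (Suc n) * (\<Prod>j\<in>{1..n}. G j)" for G :: "nat \<Rightarrow> complex"
    by (simp add: mult.commute)
  ultimately show ?case
    by (simp only: Suc.IH t_def)
qed

text \<open>The exponents of 2 are the first \<open>n\<close> odd numbers, whose sum is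
  \<open>n\<^sup>2\<close>; this is the origin of the power of 2 in the Haar density.\<close>

lemma prod_two_four_power: "(\<Prod>j\<in>{1..n}. 2 * 4 ^ (j - 1)) = (2 :: complex) ^ n\<^sup>2"
proof (induction n)
  case (Suc n)
  have "(2 :: complex) ^ (Suc n)\<^sup>2 = 2 ^ n\<^sup>2 * (2 * (2\<^sup>2) ^ n)"
  proof -
    have "(Suc n)\<^sup>2 = n\<^sup>2 + Suc (2 * n)"
      by (simp add: power2_eq_square)
    then show ?thesis
      by (simp only: power_add power_Suc power_mult)
  qed
  then show ?case
    using Suc by simp
qed simp

lemma potential_cis:
  assumes p: "(\<lambda>m. norm (p m) / real m) summable_on {1..}"
  shows "potential p (cis (- t)) + potential p (cis t)
    = 2 * (\<Sum>\<^sub>\<infinity>m\<in>{1..}. p m / of_nat m * of_real (cos (real m * t)))"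
proof -
  have "potential p (cis (- t)) + potential p (cis t)
      = (\<Sum>\<^sub>\<infinity>m\<in>{1..}. p m / of_nat m * cis (- t) ^ m + p m / of_nat m * cis t ^ m)"
    unfolding potential_def
    by (rule infsum_add[symmetric]) (intro coupling_term_summable[OF p] norm_cis)+
  also have "\<dots> = (\<Sum>\<^sub>\<infinity>m\<in>{1..}. 2 * (p m / of_nat m * of_real (cos (real m * t))))"
  proof (rule infsum_cong)
    fix m
    have "cis (- t) ^ m + cis t ^ m = 2 * of_real (cos (real m * t))"
      by (simp add: Complex.DeMoivre complex_eq_iff)
    then show "p m / of_nat m * cis (- t) ^ m + p m / of_nat m * cis t ^ m
        = 2 * (p m / of_nat m * of_real (cos (real m * t)))"
      by (metis distrib_left mult.left_commute)
  qed
  also have "\<dots> = 2 * (\<Sum>\<^sub>\<infinity>m\<in>{1..}. p m / of_nat m * of_real (cos (real m * t)))"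
    by (rule infsum_cmult_right')
  finally show ?thesis .
qed

text \<open>Separated from the ordered domain, on which symmetry under permutations could not be
  stated.\<close>

definition sp_integrand :: "nat \<Rightarrow> (nat \<Rightarrow> complex) \<Rightarrow> (nat \<Rightarrow> real) \<Rightarrow> complex" where
  "sp_integrand n p \<theta> = (\<Prod>j\<in>{1..n}. \<Prod>i\<in>{1..<j}. complex_of_real ((cos (\<theta> i) - cos (\<theta> j))\<^sup>2)) *
    (\<Prod>i\<in>{1..n}. exp (2 * (\<Sum>\<^sub>\<infinity>m\<in>{1..}. p m / of_nat m * complex_of_real (cos (real m * \<theta> i)))) *
       complex_of_real ((sin (\<theta> i))\<^sup>2))"

lemma weighted_field_prod_eq_sp_integrand:
  assumes p: "(\<lambda>m. norm (p m) / real m) summable_on {1..}"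
  shows "(\<Prod>i\<in>{1..n}. pair_weight (\<theta> i)) * field_prod (angle_points n \<theta>) (packed (2 * n))
      * exp (\<Sum>z\<leftarrow>angle_points n \<theta>. potential p z)
    = 2 ^ n\<^sup>2 / of_real pi ^ n * ((\<Prod>i\<in>{1..n}. indicator {0..pi} (\<theta> i)) * sp_integrand n p \<theta>)"
proof -
  define K where "K = (\<lambda>i j. complex_of_real ((cos (\<theta> i) - cos (\<theta> j))\<^sup>2))"
  define L where "L = (\<lambda>i. exp (2 * (\<Sum>\<^sub>\<infinity>m\<in>{1..}. p m / of_nat m * complex_of_real (cos (real m * \<theta> i)))))"
  have exp_eq: "exp (\<Sum>z\<leftarrow>angle_points n \<theta>. potential p z) = (\<Prod>i\<in>{1..n}. L i)"
  proof -
    have "(\<Sum>z\<leftarrow>angle_points n \<theta>. potential p z)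
        = (\<Sum>i\<in>{1..n}. potential p (cis (- \<theta> i)) + potential p (cis (\<theta> i)))"
      by (induction n) (simp_all add: add_ac)
    then show ?thesis
      unfolding L_def by (simp add: potential_cis[OF p] exp_sum)
  qed
  \<comment> \<open>The weight supplies \<open>\<i> / pi\<close> and one sine, the Vandermonde
    factor \<open>- 2 * \<i>\<close> and the other: together 2 / pi times the squared sine. Every
    \<open>i < j\<close> adds a factor 4 from the doubled cosines.\<close>
  have "pair_weight (\<theta> j) * (- 2 * \<i> * of_real (sin (\<theta> j)) * (\<Prod>i\<in>{1..<j}. of_real ((2 * cos (\<theta> j) - 2 * cos (\<theta> i))\<^sup>2))) * L j
      = 2 * 4 ^ (j - 1) * (1 / of_real pi) * (indicator {0..pi} (\<theta> j) * ((\<Prod>i\<in>{1..<j}. K i j) * (L j * of_real ((sin (\<theta> j))\<^sup>2))))"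
    for j
  proof -
    have "complex_of_real ((2 * cos (\<theta> j) - 2 * cos (\<theta> i))\<^sup>2) = 4 * K i j" for i
      by (simp add: K_def power2_eq_square algebra_simps)
    then have pairs: "(\<Prod>i\<in>{1..<j}. complex_of_real ((2 * cos (\<theta> j) - 2 * cos (\<theta> i))\<^sup>2)) = 4 ^ (j - 1) * (\<Prod>i\<in>{1..<j}. K i j)"
      by (simp add: prod.distrib)
    show ?thesis
      unfolding pairs by (simp add: pair_weight_def indicator_def power2_eq_square mult_ac)
  qed
  then have "(\<Prod>i\<in>{1..n}. pair_weight (\<theta> i)) * field_prod (angle_points n \<theta>) (packed (2 * n)) * (\<Prod>i\<in>{1..n}. L i)
      = (\<Prod>j\<in>{1..n}. 2 * 4 ^ (j - 1) * (1 / of_real pi) * (indicator {0..pi} (\<theta> j) * ((\<Prod>i\<in>{1..<j}. K i j) * (L j * of_real ((sin (\<theta> j))\<^sup>2)))))"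
    unfolding field_prod_angle_points prod.distrib[symmetric] by (intro prod.cong refl)
  also have "\<dots> = (\<Prod>j\<in>{1..n}. 2 * 4 ^ (j - 1)) * (\<Prod>j\<in>{1..n}. 1 / of_real pi) *
      ((\<Prod>j\<in>{1..n}. indicator {0..pi} (\<theta> j)) * ((\<Prod>j\<in>{1..n}. \<Prod>i\<in>{1..<j}. K i j) * (\<Prod>j\<in>{1..n}. L j * of_real ((sin (\<theta> j))\<^sup>2))))"
    by (simp only: prod.distrib)
  also have "\<dots> = 2 ^ n\<^sup>2 / of_real pi ^ n * ((\<Prod>i\<in>{1..n}. indicator {0..pi} (\<theta> i)) * sp_integrand n p \<theta>)"
    unfolding prod_two_four_power sp_integrand_def K_def L_def
    by (simp only: prod_constant card_atLeastAtMost power_one_over diff_Suc_1 times_divide_eq_right mult_1_right)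
  finally show ?thesis
    by (simp only: exp_eq)
qed

section \<open>Symmetry of the integrand and comparison of the two sides\<close>

lemma sp_integrand_permute:
  assumes "\<sigma> permutes {1..n}"
  shows "sp_integrand n p (\<theta> \<circ> \<sigma>) = sp_integrand n p \<theta>"
proof -
  have "(\<Prod>j\<in>{1..n}. \<Prod>i\<in>{1..<j}. complex_of_real ((cos ((\<theta> \<circ> \<sigma>) i) - cos ((\<theta> \<circ> \<sigma>) j))\<^sup>2))
      = (\<Prod>j\<in>{1..n}. \<Prod>i\<in>{1..<j}. complex_of_real ((cos (\<theta> i) - cos (\<theta> j))\<^sup>2))"
    using prod_pairs_permute[OF assms, of "\<lambda>i. cos (\<theta> i)"] unfolding of_real_prod[symmetric] comp_def
    by (rule arg_cong)
  moreover have "(\<Prod>i\<in>{1..n}. h ((\<theta> \<circ> \<sigma>) i)) = (\<Prod>i\<in>{1..n}. h (\<theta> i))" for h :: "real \<Rightarrow> complex"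
    using prod.permute[OF assms, of "\<lambda>i. h (\<theta> i)"] by (simp add: comp_def)
  from this[of "\<lambda>t. exp (2 * (\<Sum>\<^sub>\<infinity>m\<in>{1..}. p m / of_nat m * complex_of_real (cos (real m * t)))) *
    complex_of_real ((sin t)\<^sup>2)"]
  have "(\<Prod>i\<in>{1..n}. exp (2 * (\<Sum>\<^sub>\<infinity>m\<in>{1..}. p m / of_nat m * complex_of_real (cos (real m * (\<theta> \<circ> \<sigma>) i)))) *
        complex_of_real ((sin ((\<theta> \<circ> \<sigma>) i))\<^sup>2))
      = (\<Prod>i\<in>{1..n}. exp (2 * (\<Sum>\<^sub>\<infinity>m\<in>{1..}. p m / of_nat m * complex_of_real (cos (real m * \<theta> i)))) *
        complex_of_real ((sin (\<theta> i))\<^sup>2))" .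
  ultimately show ?thesis
    unfolding sp_integrand_def by (simp only:)
qed

lemma sp_integrand_ties:
  assumes "\<not> inj_on \<theta> {1..n}"
  shows "sp_integrand n p \<theta> = 0"
proof -
  obtain i j where "i \<in> {1..n}" "j \<in> {1..n}" "i \<noteq> j" "\<theta> i = \<theta> j"
    using assms by (auto simp: inj_on_def)
  then obtain i j where ij: "j \<in> {1..n}" "i \<in> {1..<j}" "\<theta> i = \<theta> j"
    by (metis atLeastAtMost_iff atLeastLessThan_iff linorder_neqE_nat)
  have "(\<Prod>i\<in>{1..<j}. complex_of_real ((cos (\<theta> i) - cos (\<theta> j))\<^sup>2)) = 0"
    by (rule prod_zero[OF _ bexI[OF _ ij(2)]]) (simp_all add: ij(3))
  then have "(\<Prod>j\<in>{1..n}. \<Prod>i\<in>{1..<j}. complex_of_real ((cos (\<theta> i) - cos (\<theta> j))\<^sup>2)) = 0"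
    by (intro prod_zero[OF _ bexI[OF _ ij(1)]]) simp
  then show ?thesis
    by (simp add: sp_integrand_def)
qed

theorem proposition2:
  fixes n :: nat and p :: "nat \<Rightarrow> complex"
  assumes "n \<ge> 1"
    and "(\<lambda>m. norm (p m) / real m) summable_on {1..}"
  shows "sp_integral n p = bra (2 * n) (Gamma_op p (op_exp pair_contour ket0)) \<and>
    bra (2 * n) (Gamma_op p (op_exp pair_contour ket0)) =
    bra (2 * n) (Gamma_op p (op_exp pair_sum ket0))"
proof -
  define f where "f = (\<lambda>\<theta>. (\<Prod>i\<in>{1..n}. indicator {0..pi} (\<theta> i)) * sp_integrand n p \<theta>)"
  define c where "c = 2 ^ n\<^sup>2 / complex_of_real pi ^ n"
  have F: "(\<Prod>i\<in>{1..n}. pair_weight (\<theta> i)) / fact n * field_prod (angle_points n \<theta>) (packed (2 * n))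
      * exp (\<Sum>z\<leftarrow>angle_points n \<theta>. potential p z) = c / fact n * f \<theta>" for \<theta>
    using weighted_field_prod_eq_sp_integrand[OF assms(2), of \<theta> n] by (simp add: f_def c_def)
  have c: "c \<noteq> 0"
    by (simp add: c_def)
  have "integrable (angle_space n) (\<lambda>\<theta>. c / fact n * f \<theta>)"
    using bra_Gamma_op_exp_pair_sum(2)[OF assms(2), of n] unfolding F .
  \<comment> \<open>Integrability is inherited from the fermionic side, so the nonzero constant has
    to be divided out again.\<close>
  then have "integrable (angle_space n) (\<lambda>\<theta>. fact n / c * (c / fact n * f \<theta>))"
    by (rule integrable_mult_right)
  then have "integrable (angle_space n) f"
    using c by simp
  then have sym: "(\<integral>\<theta>. f \<theta> \<partial>angle_space n)
      = fact n * (\<integral>\<theta>. indicator {\<theta>. mono_on {1..n} \<theta>} \<theta> *\<^sub>R f \<theta> \<partial>angle_space n)"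
  proof (rule integral_symmetric_eq_chamber)
    fix \<theta> :: "nat \<Rightarrow> real" and \<sigma> assume \<sigma>: "\<sigma> permutes {1..n}"
    have "(\<Prod>i\<in>{1..n}. indicator {0..pi} ((\<theta> \<circ> \<sigma>) i)) = (\<Prod>i\<in>{1..n}. indicator {0..pi} (\<theta> i) :: complex)"
      using prod.permute[OF \<sigma>, of "\<lambda>i. indicator {0..pi} (\<theta> i) :: complex"] by (simp add: comp_def)
    then show "f (\<theta> \<circ> \<sigma>) = f \<theta>"
      by (simp only: f_def sp_integrand_permute[OF \<sigma>])
  next
    fix \<theta> :: "nat \<Rightarrow> real" assume "\<not> inj_on \<theta> {1..n}"
    then have "sp_integrand n p \<theta> = 0"
      by (rule sp_integrand_ties)
    then show "f \<theta> = 0"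
      by (simp add: f_def)
  qed
  \<comment> \<open>Points of the product space are extensional, so membership in the
    \<open>PiE\<close> domain comes down to the range condition encoded by the indicators.\<close>
  have "indicator {\<theta>. mono_on {1..n} \<theta>} \<theta> *\<^sub>R f \<theta>
      = indicator {\<theta> \<in> {1..n} \<rightarrow>\<^sub>E {0..pi}. mono_on {1..n} \<theta>} \<theta> *\<^sub>R sp_integrand n p \<theta>"
    if "\<theta> \<in> space (angle_space n)" for \<theta>
  proof -
    have ext: "\<theta> \<in> extensional {1..n}"
      using that by (auto simp: space_PiM PiE_def)
    show ?thesis
    proof (cases "\<forall>i\<in>{1..n}. \<theta> i \<in> {0..pi}")
      case True
      then have "(\<Prod>i\<in>{1..n}. indicator {0..pi} (\<theta> i)) = (1 :: complex)"
        by (intro prod.neutral) (simp add: indicator_def)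
      moreover have "\<theta> \<in> {1..n} \<rightarrow>\<^sub>E {0..pi}"
        using True ext by (auto simp: PiE_def)
      ultimately show ?thesis
        by (simp add: f_def indicator_def)
    next
      case False
      then have "(\<Prod>i\<in>{1..n}. indicator {0..pi} (\<theta> i)) = (0 :: complex)"
        by (intro prod_zero) (auto simp: indicator_def)
      moreover have "\<theta> \<notin> {1..n} \<rightarrow>\<^sub>E {0..pi}"
        using False by (auto simp: PiE_def)
      ultimately show ?thesis
        by (simp add: f_def indicator_def)
    qed
  qed
  then have "sp_integral n p = c * (\<integral>\<theta>. indicator {\<theta>. mono_on {1..n} \<theta>} \<theta> *\<^sub>R f \<theta> \<partial>angle_space n)"
    unfolding sp_integral_def c_def set_lebesgue_integral_def sp_integrand_def[symmetric]
    by (intro arg_cong[where f = "(*) _"] Bochner_Integration.integral_cong refl) simp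
  \<comment> \<open>The number of orderings of the angles cancels the \<open>1 / fact n\<close> of
    the exponential series.\<close>
  also have "\<dots> = (\<integral>\<theta>. c / fact n * f \<theta> \<partial>angle_space n)"
    using sym by simp
  also have "\<dots> = bra (2 * n) (Gamma_op p (op_exp pair_sum ket0))"
    unfolding bra_Gamma_op_exp_pair_sum(1)[OF assms(2)] F ..
  finally show ?thesis
    by (simp add: op_exp_pair_contour_ket0)
qed

end
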